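(* Let $\alpha\ge 0$ be real and let $d,k,\gamma,h_0,T_\infty>0$. Consider the one-phase Stefan problem of finding a temperature $\Psi(x,t)$ and a moving interface $s(t)$ such that \begin{align*} &\Psi_t(x,t)=d\,\Psi_{xx}(x,t), && 0<x<s(t),\ t>0,\\ &s(0)=0,\\ &\Psi(s(t),t)=0, && t>0,\\ &k\Psi_x(0,t)=h_0t^{-1/2}\left[\Psi(0,t)-T_\infty t^{\alpha/2}\right], && t>0,\\ &k\Psi_x(s(t),t)=-\gamma\, s(t)^{\alpha}\,\dot s(t), && t>0. \end{align*} There exists a unique solution of similarity type of this problem, and it is given by $$\Psi(x,t)=t^{\alpha/2}\left[c_{11}M\left(-\tfrac{\alpha}{2},\tfrac12,-\eta^2\right)+c_{21}\,\eta\, M\left(-\tfrac{\alpha}{2}+\tfrac12,\tfrac32,-\eta^2\right)\right],\qquad s(t)=2\nu\sqrt{dt},$$ where $\eta=\dfrac{x}{2\sqrt{dt}}$, $$c_{11}=\frac{-\nu M\left(-\frac{\alpha}{2}+\frac12,\frac32,-\nu^2\right)}{M\left(-\frac{\alpha}{2},\frac12,-\nu^2\right)}\,c_{21},\qquad c_{21}=\frac{-2h_0\sqrt d\,T_\infty M\left(-\frac{\alpha}{2},\frac12,-\nu^2\right)}{kM\left(-\frac{\alpha}{2},\frac12,-\nu^2\right)+2\sqrt d\,h_0\,\nu M\left(-\frac{\alpha}{2}+\frac12,\frac32,-\nu^2\right)},$$ and the coefficient $\nu$ is the unique positive solution of the equation $$\frac{h_0T_\infty}{\gamma 2^{\alpha}d^{(\alpha+1)/2}}\,f_1(x)=x^{\alpha+1},\qquad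 x>0,$$ with $$f_1(x)=\frac{1}{M\left(\frac{\alpha}{2}+\frac12,\frac12,x^2\right)+2\frac{\sqrt d\,h_0}{k}\,x\,M\left(\frac{\alpha}{2}+1,\frac32,x^2\right)}.$$
   Context: $M(a,b,z)$ is the Kummer function $M(a,b,z)=\sum_{j=0}^{\infty}\frac{(a)_j}{(b)_j\,j!}z^j$ ($b$ not a non-positive integer), where $(a)_0=1$ and $(a)_j=a(a+1)\cdots(a+j-1)$. A solution is understood classically: $s$ is continuous on $[0,\infty)$, positive and differentiable for $t>0$; $\Psi$ is defined for $0\le x\le s(t)$, $t>0$, has the derivatives $\Psi_t,\Psi_{xx}$ for $0<x<s(t)$, and $\Psi,\Psi_x$ are continuous up to $x=0$ and $x=s(t)$. A solution is of similarity type if $\Psi(x,t)=t^{\alpha/2}f(\eta)$ for some real function $f$ of the single variable $\eta=x/(2\sqrt{dt})$. *)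

theory Defs
  imports "HOL-Analysis.Analysis"
begin

(* Meaningful when b is not a non-positive integer; the series then converges for every z. *)
definition kummer_M :: "real \<Rightarrow> real \<Rightarrow> real \<Rightarrow> real" where
  "kummer_M a b z = (\<Sum>j. pochhammer a j / (pochhammer b j * fact j) * z ^ j)"

definition closed_domain :: "(real \<Rightarrow> real) \<Rightarrow> (real \<times> real) set" where
  "closed_domain s = {(x, t). 0 < t \<and> 0 \<le> x \<and> x \<le> s t}"

(* Only the values of Psi on closed_domain s and of s on [0, infinity) matter, although both are
   total functions here.  Psi_x is a one-sided derivative at x = 0 and x = s t, which is what
   "at x within {0..s t}" says; continuity of Psi and Psi_x up to the two boundaries is joint
   continuity in (x, t), for t > 0. *)
definition stefan_solution ::
  "real \<Rightarrow> real \<Rightarrow> real \<Rightarrow> real \<Rightarrow> real \<Rightarrow> real \<Rightarrow> (real \<Rightarrow> real \<Rightarrow> real) \<Rightarrow> (real \<Rightarrow> real) \<Rightarrow> bool" where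
  "stefan_solution \<alpha> d k \<gamma> h\<^sub>0 Tinf \<Psi> s \<longleftrightarrow>
     continuous_on {0..} s \<and> (\<forall>t>0. 0 < s t) \<and>
     (\<exists>ds \<Psi>\<^sub>t \<Psi>\<^sub>x \<Psi>\<^sub>x\<^sub>x.
        (\<forall>t>0. (s has_real_derivative ds t) (at t)) \<and>
        (\<forall>t>0. \<forall>x\<in>{0<..<s t}. ((\<lambda>\<tau>. \<Psi> x \<tau>) has_real_derivative \<Psi>\<^sub>t x t) (at t)) \<and>
        (\<forall>t>0. \<forall>x\<in>{0..s t}.
           ((\<lambda>y. \<Psi> y t) has_real_derivative \<Psi>\<^sub>x x t) (at x within {0..s t})) \<and>
        (\<forall>t>0. \<forall>x\<in>{0<..<s t}. ((\<lambda>y. \<Psi>\<^sub>x y t) has_real_derivative \<Psi>\<^sub>x\<^sub>x x t) (at x)) \<and>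
        continuous_on (closed_domain s) (\<lambda>(x, t). \<Psi> x t) \<and>
        continuous_on (closed_domain s) (\<lambda>(x, t). \<Psi>\<^sub>x x t) \<and>
        (\<forall>t>0. \<forall>x\<in>{0<..<s t}. \<Psi>\<^sub>t x t = d * \<Psi>\<^sub>x\<^sub>x x t) \<and>
        s 0 = 0 \<and>
        (\<forall>t>0. \<Psi> (s t) t = 0) \<and>
        (\<forall>t>0. k * \<Psi>\<^sub>x 0 t = h\<^sub>0 * t powr (-1/2) * (\<Psi> 0 t - Tinf * t powr (\<alpha>/2))) \<and>
        (\<forall>t>0. k * \<Psi>\<^sub>x (s t) t = - \<gamma> * s t powr \<alpha> * ds t))"

definition similarity_type ::
  "real \<Rightarrow> real \<Rightarrow> (real \<Rightarrow> real \<Rightarrow> real) \<Rightarrow> (real \<Rightarrow> real) \<Rightarrow> bool" where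
  "similarity_type \<alpha> d \<Psi> s \<longleftrightarrow>
     (\<exists>f :: real \<Rightarrow> real. \<forall>t>0. \<forall>x\<in>{0..s t}. \<Psi> x t = t powr (\<alpha>/2) * f (x / (2 * sqrt (d * t))))"

definition f\<^sub>1 :: "real \<Rightarrow> real \<Rightarrow> real \<Rightarrow> real \<Rightarrow> real \<Rightarrow> real" where
  "f\<^sub>1 \<alpha> d k h\<^sub>0 x =
     1 / (kummer_M (\<alpha>/2 + 1/2) (1/2) (x\<^sup>2)
          + 2 * (sqrt d * h\<^sub>0 / k) * x * kummer_M (\<alpha>/2 + 1) (3/2) (x\<^sup>2))"

definition front_equation ::
  "real \<Rightarrow> real \<Rightarrow> real \<Rightarrow> real \<Rightarrow> real \<Rightarrow> real \<Rightarrow> real \<Rightarrow> bool" where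
  "front_equation \<alpha> d k \<gamma> h\<^sub>0 Tinf x \<longleftrightarrow>
     h\<^sub>0 * Tinf / (\<gamma> * 2 powr \<alpha> * d powr ((\<alpha> + 1)/2)) * f\<^sub>1 \<alpha> d k h\<^sub>0 x = x powr (\<alpha> + 1)"

definition c\<^sub>2\<^sub>1 :: "real \<Rightarrow> real \<Rightarrow> real \<Rightarrow> real \<Rightarrow> real \<Rightarrow> real \<Rightarrow> real" where
  "c\<^sub>2\<^sub>1 \<alpha> d k h\<^sub>0 Tinf \<nu> =
     (- 2 * h\<^sub>0 * sqrt d * Tinf * kummer_M (-\<alpha>/2) (1/2) (-(\<nu>\<^sup>2)))
     / (k * kummer_M (-\<alpha>/2) (1/2) (-(\<nu>\<^sup>2))
        + 2 * sqrt d * h\<^sub>0 * \<nu> * kummer_M (-\<alpha>/2 + 1/2) (3/2) (-(\<nu>\<^sup>2)))"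

definition c\<^sub>1\<^sub>1 :: "real \<Rightarrow> real \<Rightarrow> real \<Rightarrow> real \<Rightarrow> real \<Rightarrow> real \<Rightarrow> real" where
  "c\<^sub>1\<^sub>1 \<alpha> d k h\<^sub>0 Tinf \<nu> =
     (- \<nu> * kummer_M (-\<alpha>/2 + 1/2) (3/2) (-(\<nu>\<^sup>2))) / kummer_M (-\<alpha>/2) (1/2) (-(\<nu>\<^sup>2))
     * c\<^sub>2\<^sub>1 \<alpha> d k h\<^sub>0 Tinf \<nu>"

definition temperature ::
  "real \<Rightarrow> real \<Rightarrow> real \<Rightarrow> real \<Rightarrow> real \<Rightarrow> real \<Rightarrow> real \<Rightarrow> real \<Rightarrow> real" where
  "temperature \<alpha> d k h\<^sub>0 Tinf \<nu> x t =
     (let \<eta> = x / (2 * sqrt (d * t)) in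
      t powr (\<alpha>/2) *
        (c\<^sub>1\<^sub>1 \<alpha> d k h\<^sub>0 Tinf \<nu> * kummer_M (-\<alpha>/2) (1/2) (-(\<eta>\<^sup>2))
         + c\<^sub>2\<^sub>1 \<alpha> d k h\<^sub>0 Tinf \<nu> * \<eta> * kummer_M (-\<alpha>/2 + 1/2) (3/2) (-(\<eta>\<^sup>2))))"

definition front :: "real \<Rightarrow> real \<Rightarrow> real \<Rightarrow> real" where
  "front d \<nu> t = 2 * \<nu> * sqrt (d * t)"

end

theory Submission
  imports Defs
begin

text \<open>Put \<eta> = x / (2 sqrt(d t)). A function t^(\<alpha>/2) f(\<eta>) solves the heat equation exactly when
f'' + 2 \<eta> f' - 2 \<alpha> f = 0. Two solutions of this equation are the even profile
M(-\<alpha>/2, 1/2, -\<eta>^2) and the odd profile \<eta> M(-\<alpha>/2 + 1/2, 3/2, -\<eta>^2): for both, it becomes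
Kummer's equation \<open>kummer_equation\<close> in the variable -\<eta>^2. The Wronskian of any two solutions is a constant
times exp(-\<eta>^2) (\<open>wronskian\<close>), and the constant is 1 for the two profiles. Three facts follow.

\<^item> Every solution on an interval starting at 0 is f(0) times the even profile plus f'(0) times
  the odd one (\<open>profile_representation\<close>).
\<^item> The quotient of the odd by the even profile is strictly increasing on \<eta> \<ge> 0
  (\<open>odd_even_ratio_strict_mono\<close>). The even profile has no zero because Kummer's transformation
  \<open>kummer_transformation\<close> turns it into exp(-\<eta>^2) times a series with positive terms.
\<^item> At a zero of f, the slope of f is a known multiple of f'(0) (\<open>profile_slope_at_zero\<close>).

Now take a similarity solution and put L(t) = s(t) / (2 sqrt(d t)). The value f(0), and by the
condition at x = 0 also the slope f'(0), is the same for every t; the slope is not 0, since otherwise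
f would vanish. The condition \<Psi>(s(t), t) = 0 says that the quotient of the profiles at L(t) is
-f(0) / f'(0). By strict monotonicity L(t) is therefore a constant \<nu>, and the front is
2 \<nu> sqrt(d t). The conditions f(\<nu>) = 0 and the one at 0 are linear in f(0) and f'(0), with the
solution \<open>c\<^sub>1\<^sub>1\<close>, \<open>c\<^sub>2\<^sub>1\<close>. The Stefan condition then involves only \<nu>, and Kummer's
transformation turns it into the front equation (\<open>front_equation_iff_flux\<close>). That equation has one
positive root: its left-hand side decreases, since \<open>f\<^sub>1\<close> is the reciprocal of an increasing function,
while x^(\<alpha>+1) increases from 0 to infinity (\<open>front_equation_ex1\<close>). All these steps can be reversed,
so that root gives a solution.\<close>

section \<open>The Kummer function as a power series\<close>

lemma kummer_coeff_Suc:
  fixes a b :: real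
  shows "pochhammer a (Suc j) / (pochhammer b (Suc j) * fact (Suc j))
       = pochhammer a j / (pochhammer b j * fact j) * ((a + real j) / ((b + real j) * (1 + real j)))"
  by (simp add: pochhammer_Suc mult_ac)

text \<open>The quotient of consecutive terms is of order z/j, hence at most 1/2 in absolute value from some index
on. If b is a non-positive integer, all terms from some index on are 0, because division by zero
yields 0.\<close>
lemma summable_norm_kummer_M:
  fixes a b z :: real
  shows "summable (\<lambda>j. norm (pochhammer a j / (pochhammer b j * fact j) * z ^ j))"
proof -
  let ?t = "\<lambda>j. pochhammer a j / (pochhammer b j * fact j) * z ^ j"
  \<comment> \<open>For j \<ge> N this gives \<bar>b + j\<bar> \<ge> j/2, \<bar>a + j\<bar> \<le> 2 j and \<bar>z\<bar> \<le> j/8.\<close>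
  obtain N where N: "real N > max (2 * \<bar>b\<bar>) (max \<bar>a\<bar> (8 * \<bar>z\<bar>))"
    using reals_Archimedean2 by blast
  have quot: "norm ((a + real j) / ((b + real j) * (1 + real j)) * z) \<le> 1/2" if "j \<ge> N" for j
  proof -
    have j: "2 * \<bar>b\<bar> < real j" "\<bar>a\<bar> < real j" "8 * \<bar>z\<bar> < real j"
      using N that by (simp_all add: max_def split: if_splits)
    have "\<bar>a + real j\<bar> * \<bar>z\<bar> \<le> (2 * real j) * (real j / 8)"
      using j by (intro mult_mono) auto
    also have "\<dots> \<le> 1/2 * ((real j / 2) * (1 + real j))"
      by (simp add: algebra_simps)
    also have "\<dots> \<le> 1/2 * (\<bar>b + real j\<bar> * (1 + real j))"
      using j by (intro mult_left_mono mult_right_mono) auto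
    finally have "\<bar>a + real j\<bar> * \<bar>z\<bar> \<le> 1/2 * (\<bar>b + real j\<bar> * (1 + real j))" .
    moreover have "\<bar>b + real j\<bar> * (1 + real j) > 0"
      using j by auto
    ultimately have "\<bar>a + real j\<bar> * \<bar>z\<bar> / (\<bar>b + real j\<bar> * (1 + real j)) \<le> 1/2"
      by (simp only: pos_divide_le_eq)
    then show ?thesis
      by (simp add: abs_mult)
  qed
  show ?thesis
  proof (rule summable_ratio_test[of "1/2" N])
    fix j assume "j \<ge> N"
    have "?t (Suc j) = ((a + real j) / ((b + real j) * (1 + real j)) * z) * ?t j"
      unfolding kummer_coeff_Suc by (simp add: mult_ac)
    then have "norm (?t (Suc j))
        = norm ((a + real j) / ((b + real j) * (1 + real j)) * z) * norm (?t j)"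
      by (simp only: norm_mult)
    also have "\<dots> \<le> 1/2 * norm (?t j)"
      using quot[OF \<open>j \<ge> N\<close>] by (intro mult_right_mono) auto
    finally show "norm (norm (?t (Suc j))) \<le> 1/2 * norm (norm (?t j))" by simp
  qed simp
qed

lemma summable_kummer_M:
  fixes a b z :: real
  shows "summable (\<lambda>j. pochhammer a j / (pochhammer b j * fact j) * z ^ j)"
  using summable_norm_kummer_M by (rule summable_norm_cancel)

lemma kummer_M_0 [simp]: "kummer_M a b 0 = 1"
  unfolding kummer_M_def by (subst powser_zero) simp

lemma diffs_kummer_coeff:
  fixes a b :: real
  shows "diffs (\<lambda>j. pochhammer a j / (pochhammer b j * fact j)) n
       = a / b * (pochhammer (a + 1) n / (pochhammer (b + 1) n * fact n))"
  by (simp add: diffs_def pochhammer_rec del: of_nat_Suc)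

lemma kummer_M_has_derivative:
  "(kummer_M a b has_real_derivative a / b * kummer_M (a + 1) (b + 1) z) (at z)"
proof -
  have "(kummer_M a b has_real_derivative
      (\<Sum>n. diffs (\<lambda>j. pochhammer a j / (pochhammer b j * fact j)) n * z ^ n)) (at z)"
    unfolding kummer_M_def[abs_def]
    by (rule termdiffs_strong_converges_everywhere) (rule summable_kummer_M)
  also have "(\<Sum>n. diffs (\<lambda>j. pochhammer a j / (pochhammer b j * fact j)) n * z ^ n)
      = a / b * kummer_M (a + 1) (b + 1) z"
    unfolding diffs_kummer_coeff kummer_M_def mult.assoc[of "a / b"]
    by (rule suminf_mult) (rule summable_kummer_M)
  finally show ?thesis .
qed

lemma kummer_M_chain [derivative_intros]:
  assumes "(g has_real_derivative g') (at x within A)"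
  shows "((\<lambda>x. kummer_M a b (g x)) has_real_derivative
           a / b * kummer_M (a + 1) (b + 1) (g x) * g') (at x within A)"
  using DERIV_chain2[OF kummer_M_has_derivative assms] .

text \<open>Kummer's differential equation z M'' + (b - z) M' = a M, with both derivatives written as
Kummer functions. Comparing coefficients of z^n reduces it to the recurrence
(b + n) (n + 1) c(n + 1) = (a + n) c(n).\<close>
lemma kummer_equation:
  fixes a b z :: real
  assumes "b \<notin> \<int>\<^sub>\<le>\<^sub>0"
  shows "z * (a / b * ((a + 1) / (b + 1)) * kummer_M (a + 2) (b + 2) z)
       + (b - z) * (a / b * kummer_M (a + 1) (b + 1) z) = a * kummer_M a b z"
proof -
  define c where "c = (\<lambda>j. pochhammer a j / (pochhammer b j * fact j))"
  have c_sum: "summable (\<lambda>n. c n * x ^ n)" for x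
    unfolding c_def by (rule summable_kummer_M)
  have d_sum: "summable (\<lambda>n. diffs c n * x ^ n)" for x
    by (rule termdiff_converges_all) (rule c_sum)
  have dd_sum: "summable (\<lambda>n. diffs (diffs c) n * x ^ n)" for x
    by (rule termdiff_converges_all) (rule d_sum)
  have M: "kummer_M a b = (\<lambda>x. \<Sum>n. c n * x ^ n)"
    by (simp add: c_def kummer_M_def[abs_def])
  have M': "a / b * kummer_M (a + 1) (b + 1) x = (\<Sum>n. diffs c n * x ^ n)" for x
    using termdiffs_strong_converges_everywhere[OF c_sum, of x]
    unfolding M[symmetric] by (rule DERIV_unique[OF kummer_M_has_derivative])
  have M'': "a / b * ((a + 1) / (b + 1)) * kummer_M (a + 2) (b + 2) z
      = (\<Sum>n. diffs (diffs c) n * z ^ n)"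
  proof (rule DERIV_unique)
    have "(\<lambda>x. \<Sum>n. diffs c n * x ^ n) = (\<lambda>x. a / b * kummer_M (a + 1) (b + 1) x)"
      using M' by (intro ext) simp
    then show "((\<lambda>x. a / b * kummer_M (a + 1) (b + 1) x) has_real_derivative
        (\<Sum>n. diffs (diffs c) n * z ^ n)) (at z)"
      using termdiffs_strong_converges_everywhere[OF d_sum, of z] by simp
    show "((\<lambda>x. a / b * kummer_M (a + 1) (b + 1) x) has_real_derivative
        a / b * ((a + 1) / (b + 1)) * kummer_M (a + 2) (b + 2) z) (at z)"
      using DERIV_cmult[OF kummer_M_has_derivative[of "a + 1" "b + 1" z], of "a / b"]
      by (simp add: add.assoc mult.assoc)
  qed
  \<comment> \<open>Writing z M'' and z M' with the factors n and z^(n-1) puts every series in powers z^n without an index shift.\<close>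
  have "(\<lambda>n. z * (real n * diffs c n * z ^ (n - Suc 0))) sums (z * (\<Sum>n. diffs (diffs c) n * z ^ n))"
    by (intro sums_mult diffs_equiv dd_sum)
  moreover have "(\<lambda>n. b * (diffs c n * z ^ n)) sums (b * (\<Sum>n. diffs c n * z ^ n))"
    by (intro sums_mult summable_sums d_sum)
  moreover have "(\<lambda>n. z * (real n * c n * z ^ (n - Suc 0))) sums (z * (\<Sum>n. diffs c n * z ^ n))"
    by (intro sums_mult diffs_equiv d_sum)
  ultimately have
    "(\<lambda>n. z * (real n * diffs c n * z ^ (n - Suc 0)) + b * (diffs c n * z ^ n)
        - z * (real n * c n * z ^ (n - Suc 0)))
     sums (z * (\<Sum>n. diffs (diffs c) n * z ^ n) + b * (\<Sum>n. diffs c n * z ^ n)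
        - z * (\<Sum>n. diffs c n * z ^ n))"
    by (intro sums_add sums_diff)
  moreover have "z * (real n * diffs c n * z ^ (n - Suc 0)) + b * (diffs c n * z ^ n)
        - z * (real n * c n * z ^ (n - Suc 0)) = a * (c n * z ^ n)" for n
  proof -
    have bn: "b + real n \<noteq> 0"
      using assms by (auto simp: add_eq_0_iff2)
    have "(b + real n) * diffs c n = (a + real n) * c n"
      unfolding diffs_def c_def kummer_coeff_Suc using bn by simp
    then have *: "real n * diffs c n = (a + real n) * c n - b * diffs c n" by (simp add: algebra_simps)
    have e1: "z * (real n * diffs c n * z ^ (n - Suc 0)) = (real n * diffs c n) * z ^ n"
      by (cases n) simp_all
    have e2: "z * (real n * c n * z ^ (n - Suc 0)) = real n * c n * z ^ n"
      by (cases n) simp_all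
    show ?thesis
      unfolding e1 e2 unfolding * by (simp add: algebra_simps)
  qed
  ultimately have "(\<lambda>n. a * (c n * z ^ n)) sums
     (z * (\<Sum>n. diffs (diffs c) n * z ^ n) + (b - z) * (\<Sum>n. diffs c n * z ^ n))"
    by (simp add: algebra_simps)
  moreover have "(\<lambda>n. a * (c n * z ^ n)) sums (a * kummer_M a b z)"
    unfolding M by (intro sums_mult summable_sums c_sum)
  ultimately show ?thesis
    unfolding M' M'' by (rule sums_unique2)
qed

text \<open>The coefficients of the Cauchy product of M(a, b, -z) and exp(z) are the finite sums that the
Chu-Vandermonde identity evaluates.\<close>
lemma kummer_transformation:
  fixes a b z :: real
  assumes b: "b \<notin> \<int>\<^sub>\<le>\<^sub>0"
  shows "kummer_M a b (- z) = exp (- z) * kummer_M (b - a) b z"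
proof -
  have "(\<lambda>n. \<Sum>i\<le>n. (pochhammer a i / (pochhammer b i * fact i) * (-z) ^ i) * (z ^ (n - i) /\<^sub>R fact (n - i)))
     sums (kummer_M a b (-z) * exp z)"
    unfolding kummer_M_def exp_def
    by (intro Cauchy_product_sums summable_norm_kummer_M summable_norm_exp)
  moreover have "(\<Sum>i\<le>n. (pochhammer a i / (pochhammer b i * fact i) * (-z) ^ i) * (z ^ (n - i) /\<^sub>R fact (n - i)))
     = pochhammer (b - a) n / (pochhammer b n * fact n) * z ^ n" for n
  proof -
    have nz: "\<forall>i\<in>{0..<n}. b \<noteq> - real i"
      using b by auto
    have "(pochhammer a i / (pochhammer b i * fact i) * (-z) ^ i) * (z ^ (n - i) /\<^sub>R fact (n - i))
        = z ^ n / fact n * (pochhammer a i * pochhammer (- real n) i / (of_nat (fact i) * pochhammer b i))"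
      if "i \<le> n" for i
    proof -
      have "pochhammer (- real n) i / fact i = (-1)^i * real (n choose i)"
        by (simp add: binomial_gbinomial gbinomial_pochhammer mult_ac flip: power_mult_distrib)
      also have "real (n choose i) = fact n / (fact i * fact (n - i))"
        using that by (rule binomial_fact)
      finally have p: "pochhammer (- real n) i = (-1)^i * fact n / fact (n - i)"
        by (simp add: field_simps)
      have "(-z)^i * z^(n-i) = (-1)^i * z^n"
        using that by (simp add: power_minus[of z] mult.assoc flip: power_add)
      then have "(pochhammer a i / (pochhammer b i * fact i) * (-z) ^ i) * (z ^ (n - i) /\<^sub>R fact (n - i))
          = pochhammer a i / (pochhammer b i * fact i * fact (n - i)) * ((-1) ^ i * z ^ n)"
        by (simp add: divide_inverse mult.assoc mult.left_commute)
      also have "\<dots> = z ^ n / fact n * (pochhammer a i * pochhammer (- real n) i / (of_nat (fact i) * pochhammer b i))"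
        unfolding p by (simp add: mult_ac)
      finally show ?thesis .
    qed
    then have "(\<Sum>i\<le>n. (pochhammer a i / (pochhammer b i * fact i) * (-z) ^ i) * (z ^ (n - i) /\<^sub>R fact (n - i)))
      = z ^ n / fact n * (\<Sum>i=0..n. pochhammer a i * pochhammer (- real n) i / (of_nat (fact i) * pochhammer b i))"
      by (simp add: sum_distrib_left atLeast0AtMost)
    also have "\<dots> = z ^ n / fact n * (pochhammer (b - a) n / pochhammer b n)"
      by (subst Vandermonde_pochhammer[OF nz]) (rule refl)
    finally show ?thesis by (simp add: mult_ac)
  qed
  ultimately have "kummer_M a b (-z) * exp z = kummer_M (b - a) b z"
    unfolding kummer_M_def[of "b - a"] by (simp add: sums_iff)
  then show ?thesis
    by (simp add: exp_minus field_simps)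
qed

lemma kummer_M_ge_1:
  assumes "a > 0" "b > 0" "z \<ge> 0"
  shows "kummer_M a b z \<ge> 1"
proof -
  have "(\<Sum>j\<in>{0}. pochhammer a j / (pochhammer b j * fact j) * z ^ j) \<le> kummer_M a b z"
    unfolding kummer_M_def using assms
    by (intro sum_le_suminf summable_kummer_M)
       (auto intro!: mult_nonneg_nonneg divide_nonneg_nonneg pochhammer_nonneg)
  then show ?thesis by simp
qed

lemma kummer_M_strict_mono:
  assumes "a > 0" "b > 0" "0 \<le> x" "x < y"
  shows "kummer_M a b x < kummer_M a b y"
proof (rule DERIV_pos_imp_increasing[OF \<open>x < y\<close>])
  fix z assume "x \<le> z"
  then have "kummer_M (a + 1) (b + 1) z \<ge> 1"
    using assms by (intro kummer_M_ge_1) auto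
  then have "a / b * kummer_M (a + 1) (b + 1) z > 0"
    using assms by (intro mult_pos_pos) auto
  with kummer_M_has_derivative[of a b z]
  show "\<exists>D. (kummer_M a b has_real_derivative D) (at z) \<and> 0 < D" by blast
qed

section \<open>The profile equation and its Wronskian\<close>

text \<open>The equation f'' + 2 \<eta> f' - 2 \<alpha> f = 0 for the profile of a similarity solution. Classical
solutions of the Stefan problem are smooth only inside the domain, so the equation is required on the
open interval, and up to its ends only continuity of f and f'. The derivative is a
separate argument because f can be arbitrary outside the interval, so that it need not be
differentiable at the end points.\<close>
definition profile_ode :: "real \<Rightarrow> real \<Rightarrow> (real \<Rightarrow> real) \<Rightarrow> (real \<Rightarrow> real) \<Rightarrow> bool" where
  "profile_ode \<alpha> L f f' \<longleftrightarrow>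
     continuous_on {0..L} f \<and> continuous_on {0..L} f' \<and>
     (\<forall>\<eta>\<in>{0<..<L}. (f has_real_derivative f' \<eta>) (at \<eta>) \<and>
        (f' has_real_derivative 2 * \<alpha> * f \<eta> - 2 * \<eta> * f' \<eta>) (at \<eta>))"

text \<open>Abel's identity: the first-order coefficient 2 \<eta> makes the product of the Wronskian with
exp(\<eta>^2) a constant.\<close>
lemma wronskian:
  assumes f: "profile_ode \<alpha> L f f'" and g: "profile_ode \<alpha> L g g'" and \<eta>: "\<eta> \<in> {0..L}"
  shows "f \<eta> * g' \<eta> - g \<eta> * f' \<eta> = (f 0 * g' 0 - g 0 * f' 0) * exp (- \<eta>\<^sup>2)"
proof (cases "L = 0")
  case True
  then show ?thesis using \<eta> by simp
next
  case False
  then have "0 < L" using \<eta> by simp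
  define w where "w = (\<lambda>x. (f x * g' x - g x * f' x) * exp (x\<^sup>2))"
  have "continuous_on {0..L} w"
    using f g unfolding w_def profile_ode_def by (intro continuous_intros) auto
  moreover have "(w has_real_derivative 0) (at x)" if "0 < x" "x < L" for x
  proof -
    from f g that have
      "(f has_real_derivative f' x) (at x)"
      "(f' has_real_derivative 2 * \<alpha> * f x - 2 * x * f' x) (at x)"
      "(g has_real_derivative g' x) (at x)"
      "(g' has_real_derivative 2 * \<alpha> * g x - 2 * x * g' x) (at x)"
      by (auto simp: profile_ode_def)
    then show ?thesis
      unfolding w_def by (auto intro!: derivative_eq_intros simp: algebra_simps)
  qed
  ultimately have "w \<eta> = w 0"
    using DERIV_isconst2[OF \<open>0 < L\<close>, of w \<eta>] \<eta> by auto
  then have "(f \<eta> * g' \<eta> - g \<eta> * f' \<eta>) * exp (\<eta>\<^sup>2) = f 0 * g' 0 - g 0 * f' 0"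
    by (simp add: w_def)
  then show ?thesis
    by (simp add: exp_minus field_simps)
qed

section \<open>Even and odd profile\<close>

definition even_profile :: "real \<Rightarrow> real \<Rightarrow> real" where
  "even_profile \<alpha> \<eta> = kummer_M (-\<alpha>/2) (1/2) (-(\<eta>\<^sup>2))"

definition odd_profile :: "real \<Rightarrow> real \<Rightarrow> real" where
  "odd_profile \<alpha> \<eta> = \<eta> * kummer_M (-\<alpha>/2 + 1/2) (3/2) (-(\<eta>\<^sup>2))"

lemma not_nonpos_Ints_if_pos: "(b::real) > 0 \<Longrightarrow> b \<notin> \<int>\<^sub>\<le>\<^sub>0"
  using nonpos_Ints_nonpos by fastforce

text \<open>By the chain rule with z = -\<eta>^2, the profile equation is Kummer's equation multiplied
by -4.\<close>
lemma even_profile_solves: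
  obtains e' where
    "\<And>\<eta>. (even_profile \<alpha> has_real_derivative e' \<eta>) (at \<eta>)"
    "\<And>\<eta>. (e' has_real_derivative 2 * \<alpha> * even_profile \<alpha> \<eta> - 2 * \<eta> * e' \<eta>) (at \<eta>)"
    "e' 0 = 0"
proof
  let ?a = "-\<alpha>/2" and ?b = "1/2 :: real"
  let ?e' = "\<lambda>\<eta>. ?a / ?b * kummer_M (?a + 1) (?b + 1) (-(\<eta>\<^sup>2)) * (- 2 * \<eta>)"
  show "(even_profile \<alpha> has_real_derivative ?e' \<eta>) (at \<eta>)" for \<eta>
    unfolding even_profile_def[abs_def] by (rule derivative_eq_intros refl | simp)+
  show "(?e' has_real_derivative 2 * \<alpha> * even_profile \<alpha> \<eta> - 2 * \<eta> * ?e' \<eta>) (at \<eta>)" for \<eta>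
  proof -
    let ?z = "-(\<eta>\<^sup>2)"
    let ?M1 = "?a / ?b * kummer_M (?a + 1) (?b + 1) ?z"
    let ?M2 = "?a / ?b * ((?a + 1) / (?b + 1)) * kummer_M (?a + 2) (?b + 2) ?z"
    \<comment> \<open>The letters m, m1, m2 stand for M, M' and M'' at -\<eta>^2, so that the claim is pure algebra.\<close>
    have *: "m2 * (- 2 * \<eta>) * (- 2 * \<eta>) + m1 * (- 2) = 2 * \<alpha> * m - 2 * \<eta> * (m1 * (- 2 * \<eta>))"
      if "?z * m2 + (?b - ?z) * m1 = ?a * m" for m m1 m2
      using arg_cong[OF that, of "\<lambda>x. - 4 * x"] by (simp add: algebra_simps power2_eq_square)
    have "(?e' has_real_derivative ?M2 * (- 2 * \<eta>) * (- 2 * \<eta>) + ?M1 * (- 2)) (at \<eta>)"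
      by (rule derivative_eq_intros refl | simp add: add.assoc)+
    moreover have "?z * ?M2 + (?b - ?z) * ?M1 = ?a * even_profile \<alpha> \<eta>"
      unfolding even_profile_def by (rule kummer_equation) (simp add: not_nonpos_Ints_if_pos)
    then have "?M2 * (- 2 * \<eta>) * (- 2 * \<eta>) + ?M1 * (- 2)
        = 2 * \<alpha> * even_profile \<alpha> \<eta> - 2 * \<eta> * ?e' \<eta>"
      by (rule *)
    ultimately show ?thesis by (simp only:)
  qed
qed simp

text \<open>As for the even profile, but the outer factor \<eta> raises the second parameter of Kummer's equation
to 3/2, and the factor between the two equations is -4 \<eta>.\<close>
lemma odd_profile_solves:
  obtains o' where
    "\<And>\<eta>. (odd_profile \<alpha> has_real_derivative o' \<eta>) (at \<eta>)"
    "\<And>\<eta>. (o' has_real_derivative 2 * \<alpha> * odd_profile \<alpha> \<eta> - 2 * \<eta> * o' \<eta>) (at \<eta>)"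
    "o' 0 = 1"
proof
  let ?a = "-\<alpha>/2 + 1/2" and ?b = "3/2 :: real"
  let ?M = "\<lambda>\<eta>. kummer_M ?a ?b (-(\<eta>\<^sup>2))"
  let ?M1 = "\<lambda>\<eta>. ?a / ?b * kummer_M (?a + 1) (?b + 1) (-(\<eta>\<^sup>2))"
  let ?o' = "\<lambda>\<eta>. ?M \<eta> - 2 * \<eta>\<^sup>2 * ?M1 \<eta>"
  show "(odd_profile \<alpha> has_real_derivative ?o' \<eta>) (at \<eta>)" for \<eta>
    unfolding odd_profile_def[abs_def]
    by (rule derivative_eq_intros refl | simp add: power2_eq_square)+
  show "(?o' has_real_derivative 2 * \<alpha> * odd_profile \<alpha> \<eta> - 2 * \<eta> * ?o' \<eta>) (at \<eta>)" for \<eta>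
  proof -
    let ?z = "-(\<eta>\<^sup>2)"
    let ?M2 = "?a / ?b * ((?a + 1) / (?b + 1)) * kummer_M (?a + 2) (?b + 2) ?z"
    \<comment> \<open>The letters m, m1, m2 stand for M, M' and M'' at -\<eta>^2, so that the claim is pure algebra.\<close>
    have *: "m1 * (- 2 * \<eta>) - (4 * \<eta> * m1 + m2 * (- 2 * \<eta>) * (2 * \<eta>\<^sup>2))
        = 2 * \<alpha> * (\<eta> * m) - 2 * \<eta> * (m - 2 * \<eta>\<^sup>2 * m1)"
      if "?z * m2 + (?b - ?z) * m1 = ?a * m" for m m1 m2
      using arg_cong[OF that, of "\<lambda>x. - 4 * \<eta> * x"] by (simp add: algebra_simps power2_eq_square)
    have M1: "((\<lambda>\<eta>. ?M1 \<eta>) has_real_derivative ?M2 * (- 2 * \<eta>)) (at \<eta>)"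
      by (rule derivative_eq_intros refl | simp add: add.assoc)+
    have M: "((\<lambda>\<eta>. ?M \<eta>) has_real_derivative ?M1 \<eta> * (- 2 * \<eta>)) (at \<eta>)"
      by (rule derivative_eq_intros refl | simp)+
    have "((\<lambda>\<eta>. 2 * \<eta>\<^sup>2) has_real_derivative 4 * \<eta>) (at \<eta>)"
      by (rule derivative_eq_intros refl | simp)+
    then have "(?o' has_real_derivative
        ?M1 \<eta> * (- 2 * \<eta>) - (4 * \<eta> * ?M1 \<eta> + ?M2 * (- 2 * \<eta>) * (2 * \<eta>\<^sup>2))) (at \<eta>)"
      by (intro DERIV_diff DERIV_mult M M1)
    moreover have "?z * ?M2 + (?b - ?z) * ?M1 \<eta> = ?a * ?M \<eta>"
      by (rule kummer_equation) (simp add: not_nonpos_Ints_if_pos)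
    then have "?M1 \<eta> * (- 2 * \<eta>) - (4 * \<eta> * ?M1 \<eta> + ?M2 * (- 2 * \<eta>) * (2 * \<eta>\<^sup>2))
        = 2 * \<alpha> * odd_profile \<alpha> \<eta> - 2 * \<eta> * ?o' \<eta>"
      unfolding odd_profile_def by (rule *)
    ultimately show ?thesis by (simp only:)
  qed
qed simp

lemma even_profile_0 [simp]: "even_profile \<alpha> 0 = 1"
  by (simp add: even_profile_def)

lemma odd_profile_0 [simp]: "odd_profile \<alpha> 0 = 0"
  by (simp add: odd_profile_def)

text \<open>The terms of the defining series, a power series in -\<eta>^2, have no common sign in general, so
positivity cannot be read off it. For \<alpha> > -1, Kummer's transformation makes all terms nonnegative.\<close>
lemma even_profile_kummer:
  "even_profile \<alpha> \<eta> = exp (- \<eta>\<^sup>2) * kummer_M (\<alpha>/2 + 1/2) (1/2) (\<eta>\<^sup>2)"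
  unfolding even_profile_def
  by (subst kummer_transformation) (simp_all add: not_nonpos_Ints_if_pos add.commute)

lemma odd_profile_kummer:
  "odd_profile \<alpha> \<eta> = \<eta> * exp (- \<eta>\<^sup>2) * kummer_M (\<alpha>/2 + 1) (3/2) (\<eta>\<^sup>2)"
proof -
  have "3/2 - (-\<alpha>/2 + 1/2) = \<alpha>/2 + 1" by simp
  then show ?thesis
    unfolding odd_profile_def
    by (subst kummer_transformation) (simp_all add: not_nonpos_Ints_if_pos add.commute)
qed

lemma even_profile_pos:
  assumes "\<alpha> > -1" shows "even_profile \<alpha> \<eta> > 0"
proof -
  have "kummer_M (\<alpha>/2 + 1/2) (1/2) (\<eta>\<^sup>2) \<ge> 1"
    using assms by (intro kummer_M_ge_1) auto
  then show ?thesis unfolding even_profile_kummer by (intro mult_pos_pos) auto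
qed

lemma odd_profile_nonneg:
  assumes "\<alpha> > -2" "\<eta> \<ge> 0" shows "odd_profile \<alpha> \<eta> \<ge> 0"
proof -
  have "kummer_M (\<alpha>/2 + 1) (3/2) (\<eta>\<^sup>2) \<ge> 1"
    using assms by (intro kummer_M_ge_1) auto
  then show ?thesis unfolding odd_profile_kummer using assms by simp
qed

lemma profile_odeI:
  assumes "\<And>\<eta>. (f has_real_derivative f' \<eta>) (at \<eta>)"
    and "\<And>\<eta>. (f' has_real_derivative 2 * \<alpha> * f \<eta> - 2 * \<eta> * f' \<eta>) (at \<eta>)"
  shows "profile_ode \<alpha> L f f'"
  unfolding profile_ode_def using assms
  by (auto intro!: DERIV_continuous_on intro: has_field_derivative_at_within)

lemma fundamental_wronskian:
  assumes "\<And>\<eta>. (even_profile \<alpha> has_real_derivative e' \<eta>) (at \<eta>)"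
    and "\<And>\<eta>. (e' has_real_derivative 2 * \<alpha> * even_profile \<alpha> \<eta> - 2 * \<eta> * e' \<eta>) (at \<eta>)"
    and "e' 0 = 0"
    and "\<And>\<eta>. (odd_profile \<alpha> has_real_derivative o' \<eta>) (at \<eta>)"
    and "\<And>\<eta>. (o' has_real_derivative 2 * \<alpha> * odd_profile \<alpha> \<eta> - 2 * \<eta> * o' \<eta>) (at \<eta>)"
    and "o' 0 = 1"
    and "\<eta> \<ge> 0"
  shows "even_profile \<alpha> \<eta> * o' \<eta> - odd_profile \<alpha> \<eta> * e' \<eta> = exp (- \<eta>\<^sup>2)"
  using wronskian[OF profile_odeI[OF assms(1,2)] profile_odeI[OF assms(4,5)], of \<eta> \<eta>] assms
  by simp

text \<open>The Wronskians of f with the two profiles are known from the values at 0. They are two linear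
equations for f \<eta> and f' \<eta>, whose determinant is the Wronskian of the profiles and hence not 0.\<close>
lemma profile_representation:
  assumes f: "profile_ode \<alpha> L f f'" and \<eta>: "\<eta> \<in> {0..L}"
  shows "f \<eta> = f 0 * even_profile \<alpha> \<eta> + f' 0 * odd_profile \<alpha> \<eta>"
proof -
  obtain e' where e: "\<And>\<eta>. (even_profile \<alpha> has_real_derivative e' \<eta>) (at \<eta>)"
    "\<And>\<eta>. (e' has_real_derivative 2 * \<alpha> * even_profile \<alpha> \<eta> - 2 * \<eta> * e' \<eta>) (at \<eta>)"
    "e' 0 = 0" using even_profile_solves by blast
  obtain o' where o: "\<And>\<eta>. (odd_profile \<alpha> has_real_derivative o' \<eta>) (at \<eta>)"
    "\<And>\<eta>. (o' has_real_derivative 2 * \<alpha> * odd_profile \<alpha> \<eta> - 2 * \<eta> * o' \<eta>) (at \<eta>)"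
    "o' 0 = 1" using odd_profile_solves by blast
  let ?e = "even_profile \<alpha>" and ?o = "odd_profile \<alpha>" and ?w = "exp (- \<eta>\<^sup>2)"
  have eo: "?e \<eta> * o' \<eta> - ?o \<eta> * e' \<eta> = ?w"
    using fundamental_wronskian[OF e o] \<eta> by simp
  have fe: "f \<eta> * e' \<eta> - ?e \<eta> * f' \<eta> = - f' 0 * ?w"
    using wronskian[OF f profile_odeI[OF e(1,2)] \<eta>] e(3) by simp
  have fo: "f \<eta> * o' \<eta> - ?o \<eta> * f' \<eta> = f 0 * ?w"
    using wronskian[OF f profile_odeI[OF o(1,2)] \<eta>] o(3) by simp
  have "f \<eta> * ?w = ?e \<eta> * (f \<eta> * o' \<eta> - ?o \<eta> * f' \<eta>) - ?o \<eta> * (f \<eta> * e' \<eta> - ?e \<eta> * f' \<eta>)"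
    unfolding eo[symmetric] by (simp add: algebra_simps)
  also have "\<dots> = (f 0 * ?e \<eta> + f' 0 * ?o \<eta>) * ?w"
    unfolding fe fo by (simp add: algebra_simps)
  finally show ?thesis by simp
qed

text \<open>At a zero of f, the Wronskian of f with the even profile retains only the term with
f'.\<close>
lemma profile_slope_at_zero:
  assumes f: "profile_ode \<alpha> L f f'" and "L \<ge> 0" and "f L = 0"
  shows "even_profile \<alpha> L * f' L = f' 0 * exp (- L\<^sup>2)"
proof -
  obtain e' where e: "\<And>\<eta>. (even_profile \<alpha> has_real_derivative e' \<eta>) (at \<eta>)"
    "\<And>\<eta>. (e' has_real_derivative 2 * \<alpha> * even_profile \<alpha> \<eta> - 2 * \<eta> * e' \<eta>) (at \<eta>)"
    "e' 0 = 0" using even_profile_solves by blast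
  show ?thesis
    using wronskian[OF f profile_odeI[OF e(1,2)], of L] assms(2,3) e(3) by simp
qed

text \<open>The derivative of the quotient is the Wronskian divided by the square of the even profile. This
monotonicity is what forces the front of a similarity solution to be a multiple of sqrt(d t).\<close>
lemma odd_even_ratio_strict_mono:
  assumes "\<alpha> > -1" "0 \<le> x" "x < y"
  shows "odd_profile \<alpha> x / even_profile \<alpha> x < odd_profile \<alpha> y / even_profile \<alpha> y"
proof (rule DERIV_pos_imp_increasing[OF \<open>x < y\<close>])
  fix z assume "x \<le> z"
  obtain e' where e: "\<And>\<eta>. (even_profile \<alpha> has_real_derivative e' \<eta>) (at \<eta>)"
    "\<And>\<eta>. (e' has_real_derivative 2 * \<alpha> * even_profile \<alpha> \<eta> - 2 * \<eta> * e' \<eta>) (at \<eta>)"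
    "e' 0 = 0" using even_profile_solves by blast
  obtain o' where o: "\<And>\<eta>. (odd_profile \<alpha> has_real_derivative o' \<eta>) (at \<eta>)"
    "\<And>\<eta>. (o' has_real_derivative 2 * \<alpha> * odd_profile \<alpha> \<eta> - 2 * \<eta> * o' \<eta>) (at \<eta>)"
    "o' 0 = 1" using odd_profile_solves by blast
  have nz: "even_profile \<alpha> z > 0" using assms(1) by (rule even_profile_pos)
  have "((\<lambda>x. odd_profile \<alpha> x / even_profile \<alpha> x) has_real_derivative
      (o' z * even_profile \<alpha> z - odd_profile \<alpha> z * e' z) / (even_profile \<alpha> z * even_profile \<alpha> z)) (at z)"
    using nz by (intro DERIV_divide o e) auto
  also have "o' z * even_profile \<alpha> z - odd_profile \<alpha> z * e' z = exp (- z\<^sup>2)"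
    using fundamental_wronskian[OF e o, of z] assms \<open>x \<le> z\<close> by (simp add: mult.commute)
  finally show "\<exists>D. ((\<lambda>x. odd_profile \<alpha> x / even_profile \<alpha> x) has_real_derivative D) (at z) \<and> 0 < D"
    using nz by (intro exI conjI) (assumption, simp)
qed

section \<open>The equation for the front coefficient\<close>

text \<open>The difference G of the two sides is strictly increasing and continuous, starts at a negative value
and becomes nonnegative, because the series in the denominator of \<open>f\<^sub>1\<close> have positive coefficients.\<close>
lemma front_equation_ex1:
  assumes "\<alpha> \<ge> 0" "d > 0" "k > 0" "\<gamma> > 0" "h\<^sub>0 > 0" "Tinf > 0"
  shows "\<exists>!\<nu>. \<nu> > 0 \<and> front_equation \<alpha> d k \<gamma> h\<^sub>0 Tinf \<nu>"
proof -
  define K where "K = h\<^sub>0 * Tinf / (\<gamma> * 2 powr \<alpha> * d powr ((\<alpha> + 1)/2))"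
  define D where "D = (\<lambda>x. kummer_M (\<alpha>/2 + 1/2) (1/2) (x\<^sup>2)
          + 2 * (sqrt d * h\<^sub>0 / k) * x * kummer_M (\<alpha>/2 + 1) (3/2) (x\<^sup>2))"
  define G where "G = (\<lambda>x. x powr (\<alpha> + 1) - K / D x)"
  have K: "K > 0" unfolding K_def using assms by simp
  have eq: "front_equation \<alpha> d k \<gamma> h\<^sub>0 Tinf x \<longleftrightarrow> G x = 0" for x
    unfolding front_equation_def f\<^sub>1_def G_def D_def K_def by auto
  have D1: "D x \<ge> 1" if "x \<ge> 0" for x
  proof -
    have "2 * (sqrt d * h\<^sub>0 / k) * x * kummer_M (\<alpha>/2 + 1) (3/2) (x\<^sup>2) \<ge> 0"
      using assms that kummer_M_ge_1[of "\<alpha>/2 + 1" "3/2" "x\<^sup>2"]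
      by (intro mult_nonneg_nonneg) auto
    with kummer_M_ge_1[of "\<alpha>/2 + 1/2" "1/2" "x\<^sup>2"] assms show ?thesis
      by (simp add: D_def)
  qed
  have D_mono: "D x < D y" if "0 \<le> x" "x < y" for x y
  proof -
    have xy: "x\<^sup>2 < y\<^sup>2" using that by (intro power_strict_mono) auto
    have "kummer_M (\<alpha>/2 + 1/2) (1/2) (x\<^sup>2) < kummer_M (\<alpha>/2 + 1/2) (1/2) (y\<^sup>2)"
      using assms xy by (intro kummer_M_strict_mono) auto
    moreover have "2 * (sqrt d * h\<^sub>0 / k) * x * kummer_M (\<alpha>/2 + 1) (3/2) (x\<^sup>2)
        \<le> 2 * (sqrt d * h\<^sub>0 / k) * y * kummer_M (\<alpha>/2 + 1) (3/2) (y\<^sup>2)"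
      using assms that kummer_M_ge_1[of "\<alpha>/2 + 1" "3/2" "x\<^sup>2"]
        kummer_M_strict_mono[of "\<alpha>/2 + 1" "3/2", OF _ _ _ xy]
      by (intro mult_mono mult_left_mono mult_nonneg_nonneg less_imp_le[OF \<open>x < y\<close>]) auto
    ultimately show ?thesis unfolding D_def by linarith
  qed
  have G_mono: "G x < G y" if "0 \<le> x" "x < y" for x y
  proof -
    have "x powr (\<alpha> + 1) < y powr (\<alpha> + 1)"
      using that assms by (intro powr_less_mono2) auto
    moreover have "K / D y < K / D x"
      using K D_mono[OF that] D1[OF that(1)] by (intro divide_strict_left_mono) auto
    ultimately show ?thesis unfolding G_def by linarith
  qed
  \<comment> \<open>At this point K / D X \<le> K \<le> X \<le> X powr (\<alpha> + 1).\<close>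
  define X where "X = max 1 K"
  have "D 0 = 1" by (simp add: D_def)
  then have "G 0 \<le> 0" using K by (simp add: G_def)
  moreover have "0 \<le> G X"
  proof -
    have "K / D X \<le> K / 1"
      using K D1[of X] by (intro divide_left_mono) (auto simp: X_def max_def)
    also have "\<dots> \<le> X powr 1" by (simp add: X_def)
    also have "\<dots> \<le> X powr (\<alpha> + 1)" using assms by (intro powr_mono) (auto simp: X_def)
    finally show ?thesis by (simp add: G_def)
  qed
  moreover have "continuous_on {0..X} G"
  proof -
    have "continuous_on UNIV (kummer_M a b)" for a b
      by (rule DERIV_continuous_on) (rule has_field_derivative_at_within, rule kummer_M_has_derivative)
    then have M: "continuous_on A (\<lambda>x. kummer_M a b (x\<^sup>2))" for A :: "real set" and a b
      by (rule continuous_on_compose2) (auto intro!: continuous_intros)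
    have "continuous_on {0..X} D"
      unfolding D_def by (intro continuous_intros M)
    moreover have "\<forall>x\<in>{0..X}. D x \<noteq> 0" using D1 by force
    ultimately show ?thesis
      unfolding G_def using assms
      by (intro continuous_on_diff continuous_on_powr' continuous_on_divide continuous_intros) auto
  qed
  ultimately obtain \<nu> where \<nu>: "0 \<le> \<nu>" "G \<nu> = 0"
    using IVT'[of G 0 0 X] by (auto simp: X_def max_def split: if_splits)
  moreover have "\<nu> \<noteq> 0" using \<nu>(2) K \<open>D 0 = 1\<close> by (auto simp: G_def)
  moreover have "y = \<nu>" if "y > 0" "G y = 0" for y
    using G_mono[of y \<nu>] G_mono[of \<nu> y] that \<nu> by (cases y \<nu> rule: linorder_cases) auto
  ultimately show ?thesis
    unfolding eq by (intro ex1I[of _ \<nu>]) auto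
qed

section \<open>Boundary conditions for the profile coefficients\<close>

text \<open>The two conditions are a linear system for a and b. Its determinant is positive, since the even
profile is positive and the odd one nonnegative at \<nu>; Cramer's rule gives the stated formulas.\<close>
lemma coefficients_unique:
  assumes "\<alpha> \<ge> 0" "d > 0" "k > 0" "h\<^sub>0 > 0" "\<nu> > 0"
    and zero: "a * even_profile \<alpha> \<nu> + b * odd_profile \<alpha> \<nu> = 0"
    and robin: "k * b = 2 * sqrt d * h\<^sub>0 * (a - Tinf)"
  shows "a = c\<^sub>1\<^sub>1 \<alpha> d k h\<^sub>0 Tinf \<nu>" "b = c\<^sub>2\<^sub>1 \<alpha> d k h\<^sub>0 Tinf \<nu>"
proof -
  let ?e = "even_profile \<alpha> \<nu>" and ?o = "odd_profile \<alpha> \<nu>"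
  let ?D = "k * ?e + 2 * sqrt d * h\<^sub>0 * ?o"
  have e: "?e > 0" and o: "?o \<ge> 0"
    using assms by (auto intro: even_profile_pos odd_profile_nonneg)
  have D: "?D > 0"
    using e o assms by (intro add_pos_nonneg mult_pos_pos mult_nonneg_nonneg) auto
  have a: "a = - ?o / ?e * b"
    using zero e by (simp add: field_simps)
  have "b * ?D = k * b * ?e + 2 * sqrt d * h\<^sub>0 * (b * ?o)"
    by (simp add: algebra_simps)
  also have "b * ?o = - a * ?e"
    using zero by simp
  also have "k * b * ?e + 2 * sqrt d * h\<^sub>0 * (- a * ?e) = - 2 * h\<^sub>0 * sqrt d * Tinf * ?e"
    unfolding robin by (simp add: algebra_simps)
  finally have b: "b = - 2 * h\<^sub>0 * sqrt d * Tinf * ?e / ?D"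
    using D by (simp only: nonzero_eq_divide_eq)
  then show b': "b = c\<^sub>2\<^sub>1 \<alpha> d k h\<^sub>0 Tinf \<nu>"
    by (simp add: c\<^sub>2\<^sub>1_def even_profile_def odd_profile_def mult.assoc)
  show "a = c\<^sub>1\<^sub>1 \<alpha> d k h\<^sub>0 Tinf \<nu>"
    unfolding c\<^sub>1\<^sub>1_def b'[symmetric] a by (simp add: even_profile_def odd_profile_def)
qed

lemma coefficients_boundary:
  assumes "\<alpha> \<ge> 0" "d > 0" "k > 0" "h\<^sub>0 > 0" "\<nu> > 0"
  shows "c\<^sub>1\<^sub>1 \<alpha> d k h\<^sub>0 Tinf \<nu> * even_profile \<alpha> \<nu> + c\<^sub>2\<^sub>1 \<alpha> d k h\<^sub>0 Tinf \<nu> * odd_profile \<alpha> \<nu> = 0"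
    and "k * c\<^sub>2\<^sub>1 \<alpha> d k h\<^sub>0 Tinf \<nu> = 2 * sqrt d * h\<^sub>0 * (c\<^sub>1\<^sub>1 \<alpha> d k h\<^sub>0 Tinf \<nu> - Tinf)"
proof -
  let ?e = "even_profile \<alpha> \<nu>" and ?o = "odd_profile \<alpha> \<nu>"
  let ?D = "k * ?e + 2 * sqrt d * h\<^sub>0 * ?o"
  let ?b = "c\<^sub>2\<^sub>1 \<alpha> d k h\<^sub>0 Tinf \<nu>" and ?a = "c\<^sub>1\<^sub>1 \<alpha> d k h\<^sub>0 Tinf \<nu>"
  have e: "?e > 0" and o: "?o \<ge> 0"
    using assms by (auto intro: even_profile_pos odd_profile_nonneg)
  have D: "?D > 0"
    using e o assms by (intro add_pos_nonneg mult_pos_pos mult_nonneg_nonneg) auto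
  have b: "?b = - 2 * h\<^sub>0 * sqrt d * Tinf * ?e / ?D"
    by (simp add: c\<^sub>2\<^sub>1_def even_profile_def odd_profile_def mult.assoc)
  have "?a = - ?o / ?e * ?b"
    unfolding c\<^sub>1\<^sub>1_def by (simp add: even_profile_def odd_profile_def)
  then show zero: "?a * ?e + ?b * ?o = 0"
    using e by simp
  have "?b * ?D = - 2 * h\<^sub>0 * sqrt d * Tinf * ?e"
    unfolding b using D by simp
  then have "k * ?b * ?e = 2 * sqrt d * h\<^sub>0 * (- (?b * ?o)) - 2 * sqrt d * h\<^sub>0 * Tinf * ?e"
    by (simp add: algebra_simps)
  also have "- (?b * ?o) = ?a * ?e"
    using zero by simp
  finally have "(k * ?b) * ?e = (2 * sqrt d * h\<^sub>0 * (?a - Tinf)) * ?e"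
    by (simp add: algebra_simps)
  then show "k * ?b = 2 * sqrt d * h\<^sub>0 * (?a - Tinf)"
    using e by simp
qed

text \<open>For the profile f with coefficients \<open>c\<^sub>1\<^sub>1\<close> and \<open>c\<^sub>2\<^sub>1\<close>, \<open>profile_slope_at_zero\<close> shows that the
second equation is k f'(\<nu>) = -\<gamma> (2 \<nu> sqrt d)^\<alpha> 2 \<nu> d, the Stefan condition. The
factor exp(-\<nu>^2) that Kummer's transformation extracts from both profiles cancels, which is why the
front equation contains only Kummer functions of \<nu>^2.\<close>
lemma front_equation_iff_flux:
  assumes "\<alpha> \<ge> 0" "d > 0" "k > 0" "\<gamma> > 0" "h\<^sub>0 > 0" "\<nu> > 0"
  shows "front_equation \<alpha> d k \<gamma> h\<^sub>0 Tinf \<nu> \<longleftrightarrow>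
    k * (c\<^sub>2\<^sub>1 \<alpha> d k h\<^sub>0 Tinf \<nu> * exp (- \<nu>\<^sup>2) / even_profile \<alpha> \<nu>)
      = - \<gamma> * (2 * \<nu> * sqrt d) powr \<alpha> * (2 * \<nu> * d)"
proof -
  define E where "E = kummer_M (\<alpha>/2 + 1/2) (1/2) (\<nu>\<^sup>2)"
  define O1 where "O1 = \<nu> * kummer_M (\<alpha>/2 + 1) (3/2) (\<nu>\<^sup>2)"
  define w where "w = exp (- \<nu>\<^sup>2)"
  define D where "D = k * E + 2 * sqrt d * h\<^sub>0 * O1"
  have w: "w > 0" by (simp add: w_def)
  have e: "even_profile \<alpha> \<nu> = w * E"
    by (simp add: even_profile_kummer E_def w_def)
  have o: "odd_profile \<alpha> \<nu> = w * O1"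
    by (simp add: odd_profile_kummer O1_def w_def)
  have E: "E > 0"
    using kummer_M_ge_1[of "\<alpha>/2 + 1/2" "1/2" "\<nu>\<^sup>2"] assms by (simp add: E_def)
  have O1: "O1 \<ge> 0"
    using kummer_M_ge_1[of "\<alpha>/2 + 1" "3/2" "\<nu>\<^sup>2"] assms by (simp add: O1_def)
  have D: "D > 0"
    unfolding D_def using E O1 assms by (intro add_pos_nonneg mult_pos_pos mult_nonneg_nonneg) auto
  have c: "c\<^sub>2\<^sub>1 \<alpha> d k h\<^sub>0 Tinf \<nu> = - 2 * h\<^sub>0 * sqrt d * Tinf * E / D"
  proof -
    have "c\<^sub>2\<^sub>1 \<alpha> d k h\<^sub>0 Tinf \<nu> = - 2 * h\<^sub>0 * sqrt d * Tinf * even_profile \<alpha> \<nu>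
       / (k * even_profile \<alpha> \<nu> + 2 * sqrt d * h\<^sub>0 * odd_profile \<alpha> \<nu>)"
      by (simp add: c\<^sub>2\<^sub>1_def even_profile_def odd_profile_def mult.assoc)
    also have "\<dots> = (w * (- 2 * h\<^sub>0 * sqrt d * Tinf * E)) / (w * D)"
      unfolding e o D_def by (simp add: algebra_simps)
    finally show ?thesis using w by simp
  qed
  have lhs: "k * (c\<^sub>2\<^sub>1 \<alpha> d k h\<^sub>0 Tinf \<nu> * exp (- \<nu>\<^sup>2) / even_profile \<alpha> \<nu>)
      = - (2 * sqrt d) * (h\<^sub>0 * Tinf * (k / D))"
    unfolding c e w_def[symmetric] using w E by simp
  define P where "P = \<gamma> * 2 powr \<alpha> * d powr ((\<alpha> + 1)/2)"
  have P: "P > 0" using assms by (simp add: P_def)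
  have "(2 * \<nu> * sqrt d) powr \<alpha> * (2 * \<nu> * d)
      = 2 powr \<alpha> * \<nu> powr \<alpha> * (d powr (1/2)) powr \<alpha> * (2 * \<nu> * (sqrt d * d powr (1/2)))"
    using assms by (simp add: powr_mult powr_half_sqrt)
  also have "\<dots> = 2 * sqrt d * (2 powr \<alpha> * (d powr (\<alpha>/2) * d powr (1/2)) * (\<nu> powr \<alpha> * \<nu> powr 1))"
    using assms by (simp add: powr_powr)
  also have "\<dots> = 2 * sqrt d * (2 powr \<alpha> * d powr ((\<alpha> + 1)/2) * \<nu> powr (\<alpha> + 1))"
    by (simp only: powr_add add_divide_distrib)
  finally have rhs: "- \<gamma> * (2 * \<nu> * sqrt d) powr \<alpha> * (2 * \<nu> * d)
      = - (2 * sqrt d) * (P * \<nu> powr (\<alpha> + 1))"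
    unfolding P_def mult.assoc[of "- \<gamma>"] by simp
  have "f\<^sub>1 \<alpha> d k h\<^sub>0 \<nu> = k / D"
  proof -
    have "E + 2 * (sqrt d * h\<^sub>0 / k) * O1 = D / k"
      using assms by (simp add: D_def field_simps)
    then show ?thesis
      unfolding f\<^sub>1_def E_def O1_def by (simp add: mult.assoc)
  qed
  then have "front_equation \<alpha> d k \<gamma> h\<^sub>0 Tinf \<nu> \<longleftrightarrow> h\<^sub>0 * Tinf / P * (k / D) = \<nu> powr (\<alpha> + 1)"
    unfolding front_equation_def P_def by simp
  also have "\<dots> \<longleftrightarrow> h\<^sub>0 * Tinf * (k / D) = P * \<nu> powr (\<alpha> + 1)"
  proof -
    have "h\<^sub>0 * Tinf / P * (k / D) = h\<^sub>0 * Tinf * (k / D) / P" by simp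
    moreover have "P \<noteq> 0" using P by simp
    ultimately show ?thesis
      using nonzero_divide_eq_eq[of P "h\<^sub>0 * Tinf * (k / D)" "\<nu> powr (\<alpha> + 1)"]
      by (metis mult.commute)
  qed
  also have "\<dots> \<longleftrightarrow> - (2 * sqrt d) * (h\<^sub>0 * Tinf * (k / D)) = - (2 * sqrt d) * (P * \<nu> powr (\<alpha> + 1))"
    using assms by (subst mult_cancel_left) auto
  finally show ?thesis unfolding lhs rhs .
qed

section \<open>From a profile to a solution of the Stefan problem\<close>

lemma sqrt_deriv:
  fixes d t :: real
  assumes "d > 0" "t > 0"
  shows "((\<lambda>\<tau>. sqrt (d * \<tau>)) has_real_derivative sqrt (d * t) / (2 * t)) (at t)"
proof -
  have pos: "d * t > 0" using assms by simp
  have "((\<lambda>\<tau>. sqrt (d * \<tau>)) has_real_derivative inverse (sqrt (d * t)) / 2 * d) (at t)"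
    by (rule DERIV_chain2[where f = sqrt]) (rule DERIV_real_sqrt[OF pos], rule DERIV_cmult_Id)
  also have "inverse (sqrt (d * t)) / 2 * d = sqrt (d * t) / (2 * t)"
  proof -
    have "sqrt (d * t) * sqrt (d * t) = d * t" using pos by simp
    then show ?thesis using assms pos by (simp add: field_simps)
  qed
  finally show ?thesis .
qed

lemma similarity_variable_deriv:
  fixes d t x :: real
  assumes "d > 0" "t > 0"
  shows "((\<lambda>\<tau>. x / (2 * sqrt (d * \<tau>))) has_real_derivative - (x / (2 * sqrt (d * t)) / (2 * t))) (at t)"
  using assms by (intro DERIV_cong[OF DERIV_divide[OF DERIV_const DERIV_cmult[OF sqrt_deriv]]])
    (auto simp: field_simps)

text \<open>The heat equation and the conditions at the fixed boundary and at the front carry the same power of t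
on both sides, so they reduce to conditions on the profile alone.\<close>
lemma similarity_solution_stefan:
  fixes F F' :: "real \<Rightarrow> real"
  assumes d: "d > 0" and \<nu>: "\<nu> > 0"
    and F: "\<And>\<eta>. (F has_real_derivative F' \<eta>) (at \<eta>)"
    and F': "\<And>\<eta>. (F' has_real_derivative 2 * \<alpha> * F \<eta> - 2 * \<eta> * F' \<eta>) (at \<eta>)"
    and zero: "F \<nu> = 0"
    and robin: "k * F' 0 = 2 * sqrt d * h\<^sub>0 * (F 0 - Tinf)"
    and flux: "k * F' \<nu> = - \<gamma> * (2 * \<nu> * sqrt d) powr \<alpha> * (2 * \<nu> * d)"
  shows "stefan_solution \<alpha> d k \<gamma> h\<^sub>0 Tinf
           (\<lambda>x t. t powr (\<alpha>/2) * F (x / (2 * sqrt (d * t)))) (front d \<nu>)"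
proof -
  let ?\<eta> = "\<lambda>x t. x / (2 * sqrt (d * t))"
  let ?\<Psi> = "\<lambda>x t. t powr (\<alpha>/2) * F (?\<eta> x t)"
  let ?ds = "\<lambda>t. \<nu> * sqrt (d * t) / t"
  let ?\<Psi>t = "\<lambda>x t. \<alpha>/2 * t powr (\<alpha>/2 - 1) * F (?\<eta> x t)
      - t powr (\<alpha>/2) * (F' (?\<eta> x t) * (?\<eta> x t / (2 * t)))"
  let ?\<Psi>x = "\<lambda>x t. t powr (\<alpha>/2) * (F' (?\<eta> x t) / (2 * sqrt (d * t)))"
  \<comment> \<open>The second derivative of F is replaced by the profile equation, which turns the heat equation into an identity.\<close>
  let ?\<Psi>xx = "\<lambda>x t. t powr (\<alpha>/2) * ((2 * \<alpha> * F (?\<eta> x t) - 2 * ?\<eta> x t * F' (?\<eta> x t)) / (4 * (d * t)))"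
  have at_front: "?\<eta> (front d \<nu> t) t = \<nu>" if "t > 0" for t
    using that d by (simp add: front_def)
  have \<eta>x: "((\<lambda>y. ?\<eta> y t) has_real_derivative 1 / (2 * sqrt (d * t))) (at x)" for t x
    by (intro DERIV_cdivide DERIV_ident)
  have cF: "continuous_on UNIV F" and cF': "continuous_on UNIV F'"
    using F F' by (auto intro!: DERIV_continuous_on intro: has_field_derivative_at_within)
  have c\<eta>: "continuous_on (closed_domain (front d \<nu>)) (\<lambda>p. ?\<eta> (fst p) (snd p))"
    using d by (intro continuous_intros) (auto simp: closed_domain_def)
  show ?thesis
    unfolding stefan_solution_def
  proof (intro conjI;
      (rule exI[of _ ?ds], rule exI[of _ ?\<Psi>t], rule exI[of _ ?\<Psi>x], rule exI[of _ ?\<Psi>xx],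
       intro conjI)?; (intro allI ballI impI)?)
    show "continuous_on {0..} (front d \<nu>)"
      unfolding front_def by (intro continuous_intros)
    show "front d \<nu> 0 = 0" by (simp add: front_def)
  next
    fix t :: real assume t: "0 < t"
    show "0 < front d \<nu> t" using t d \<nu> by (simp add: front_def)
    show "(front d \<nu> has_real_derivative ?ds t) (at t)"
      using DERIV_cmult[OF sqrt_deriv[OF d t], of "2 * \<nu>"] by (simp add: front_def[abs_def])
    show "?\<Psi> (front d \<nu> t) t = 0"
      unfolding at_front[OF t] zero by simp
    have tp: "t powr (-1/2) = 1 / sqrt t"
      using t by (simp add: powr_minus_divide powr_half_sqrt flip: minus_divide_left)
    show "k * ?\<Psi>x 0 t = h\<^sub>0 * t powr (-1/2) * (?\<Psi> 0 t - Tinf * t powr (\<alpha>/2))"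
    proof -
      have "k * ?\<Psi>x 0 t = t powr (\<alpha>/2) * (k * F' 0) / (2 * sqrt (d * t))" by simp
      also have "\<dots> = t powr (\<alpha>/2) * (h\<^sub>0 * (F 0 - Tinf)) / sqrt t"
        unfolding robin using d t by (simp add: real_sqrt_mult)
      finally show ?thesis unfolding tp by (simp add: algebra_simps diff_divide_distrib)
    qed
    show "k * ?\<Psi>x (front d \<nu> t) t = - \<gamma> * front d \<nu> t powr \<alpha> * ?ds t"
    proof -
      have "front d \<nu> t powr \<alpha> = (2 * \<nu> * sqrt d) powr \<alpha> * t powr (\<alpha>/2)"
        using d t \<nu> by (simp add: front_def real_sqrt_mult powr_mult powr_powr flip: powr_half_sqrt)
      moreover have "2 * \<nu> * d / (2 * sqrt (d * t)) = ?ds t"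
        using d t by (simp add: real_sqrt_mult field_simps)
      moreover have "k * ?\<Psi>x (front d \<nu> t) t = t powr (\<alpha>/2) * (k * F' \<nu>) / (2 * sqrt (d * t))"
        unfolding at_front[OF t] by simp
      moreover have "\<dots> = - \<gamma> * ((2 * \<nu> * sqrt d) powr \<alpha> * t powr (\<alpha>/2))
          * (2 * \<nu> * d / (2 * sqrt (d * t)))"
        unfolding flux by simp
      ultimately show ?thesis by (simp only:)
    qed
  next
    fix t x :: real assume t: "0 < t"
    show "((\<lambda>\<tau>. ?\<Psi> x \<tau>) has_real_derivative ?\<Psi>t x t) (at t)"
      using DERIV_mult[OF has_real_derivative_powr[OF t, of "\<alpha>/2"] DERIV_chain2[OF F similarity_variable_deriv[OF d t, of x]]]
      by (simp add: mult.commute)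
    show "((\<lambda>y. ?\<Psi> y t) has_real_derivative ?\<Psi>x x t) (at x within {0..front d \<nu> t})"
      using DERIV_cmult[OF DERIV_chain2[OF F \<eta>x[of t x]], of "t powr (\<alpha>/2)"]
      by (simp add: has_field_derivative_at_within)
    have "r * (1 / (2 * sqrt (d * t))) / (2 * sqrt (d * t)) = r / (4 * (d * t))" for r
      using d t by simp
    then show "((\<lambda>y. ?\<Psi>x y t) has_real_derivative ?\<Psi>xx x t) (at x)"
      using DERIV_cmult[OF DERIV_cdivide[OF DERIV_chain2[OF F' \<eta>x[of t x]], of "2 * sqrt (d * t)"],
          of "t powr (\<alpha>/2)"]
      by (simp only:)
    have "t powr (\<alpha>/2 - 1) = t powr (\<alpha>/2) / t"
      using t by (simp add: powr_diff)
    then show "?\<Psi>t x t = d * ?\<Psi>xx x t"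
      using d t by (simp add: field_simps)
  next
    show "continuous_on (closed_domain (front d \<nu>)) (\<lambda>(x, t). ?\<Psi> x t)"
      unfolding case_prod_beta
      by (intro continuous_intros continuous_on_compose2[OF cF c\<eta>]) (auto simp: closed_domain_def)
    show "continuous_on (closed_domain (front d \<nu>)) (\<lambda>(x, t). ?\<Psi>x x t)"
      unfolding case_prod_beta using d
      by (intro continuous_intros continuous_on_compose2[OF cF' c\<eta>]) (auto simp: closed_domain_def)
  qed
qed

section \<open>From a similarity solution to a profile\<close>

text \<open>At a fixed time the profile is a rescaled copy of \<Psi>, which gives its regularity on
the interval up to L. The profile equation comes from computing the time derivative of \<Psi> at an
interior point in a second way, from the similarity form; at a fixed x this form holds at nearby
times because the front is continuous.\<close>
lemma similarity_solution_reduces: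
  fixes \<alpha> d k \<gamma> h\<^sub>0 Tinf :: real
  assumes d: "d > 0"
    and sol: "stefan_solution \<alpha> d k \<gamma> h\<^sub>0 Tinf \<Psi> s"
    and sim: "\<And>t x. t > 0 \<Longrightarrow> x \<in> {0..s t} \<Longrightarrow> \<Psi> x t = t powr (\<alpha>/2) * f (x / (2 * sqrt (d * t)))"
    and t: "t > 0"
  defines "L \<equiv> s t / (2 * sqrt (d * t))"
  obtains f' ds where
    "profile_ode \<alpha> L f f'" "f L = 0"
    "k * f' 0 = 2 * sqrt d * h\<^sub>0 * (f 0 - Tinf)"
    "(s has_real_derivative ds) (at t)"
    "t powr (\<alpha>/2) * (k * f' L) / (2 * sqrt (d * t)) = - \<gamma> * s t powr \<alpha> * ds"
proof -
  from sol obtain ds \<Psi>t \<Psi>x \<Psi>xx where s_pos: "\<forall>t>0. 0 < s t"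
    and ds: "\<forall>t>0. (s has_real_derivative ds t) (at t)"
    and \<Psi>t: "\<forall>t>0. \<forall>x\<in>{0<..<s t}. ((\<lambda>\<tau>. \<Psi> x \<tau>) has_real_derivative \<Psi>t x t) (at t)"
    and \<Psi>x: "\<forall>t>0. \<forall>x\<in>{0..s t}.
           ((\<lambda>y. \<Psi> y t) has_real_derivative \<Psi>x x t) (at x within {0..s t})"
    and \<Psi>xx: "\<forall>t>0. \<forall>x\<in>{0<..<s t}. ((\<lambda>y. \<Psi>x y t) has_real_derivative \<Psi>xx x t) (at x)"
    and cont: "continuous_on (closed_domain s) (\<lambda>(x, t). \<Psi>x x t)"
    and heat: "\<forall>t>0. \<forall>x\<in>{0<..<s t}. \<Psi>t x t = d * \<Psi>xx x t"
    and zero: "\<forall>t>0. \<Psi> (s t) t = 0"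
    and robin: "\<forall>t>0. k * \<Psi>x 0 t = h\<^sub>0 * t powr (-1/2) * (\<Psi> 0 t - Tinf * t powr (\<alpha>/2))"
    and flux: "\<forall>t>0. k * \<Psi>x (s t) t = - \<gamma> * s t powr \<alpha> * ds t"
    unfolding stefan_solution_def by (elim conjE exE) blast
  define q where "q = 2 * sqrt (d * t)"
  define c where "c = t powr (\<alpha>/2)"
  define f' where "f' = (\<lambda>\<eta>. q / c * \<Psi>x (q * \<eta>) t)"
  have q: "q > 0" and c: "c > 0" using d t by (simp_all add: q_def c_def)
  have q2: "q * q = 4 * d * t" using d t by (simp add: q_def)
  have st: "s t = q * L" unfolding L_def q_def[symmetric] using q by simp
  have L: "L > 0" unfolding L_def q_def[symmetric] using s_pos t q by simp
  have in_dom: "q * \<eta> \<in> {0..s t}" if "\<eta> \<in> {0..L}" for \<eta>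
    using that q by (simp add: st)
  have f_eq: "f \<eta> = \<Psi> (q * \<eta>) t / c" if "\<eta> \<in> {0..L}" for \<eta>
    using sim[OF t in_dom[OF that]] q c by (simp add: q_def[symmetric] c_def[symmetric])
  have \<Psi>x_t: "((\<lambda>y. \<Psi> y t) has_real_derivative \<Psi>x x t) (at x)" if "0 < x" "x < s t" for x
    using bspec[OF mp[OF spec[OF \<Psi>x] t], of x] that by (simp add: at_within_Icc_at)
  have f_deriv: "(f has_real_derivative f' \<eta>) (at \<eta>)" if "0 < \<eta>" "\<eta> < L" for \<eta>
  proof (rule has_field_derivative_transform_within_open[where S = "{0<..<L}"])
    have "((\<lambda>\<eta>. \<Psi> (q * \<eta>) t) has_real_derivative \<Psi>x (q * \<eta>) t * q) (at \<eta>)"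
      using that q by (intro DERIV_chain2[where f = "\<lambda>y. \<Psi> y t"] \<Psi>x_t DERIV_cmult_Id) (simp_all add: st)
    then show "((\<lambda>\<eta>. \<Psi> (q * \<eta>) t / c) has_real_derivative f' \<eta>) (at \<eta>)"
      using DERIV_cdivide by (force simp: f'_def mult.commute)
    show "\<Psi> (q * x) t / c = f x" if "x \<in> {0<..<L}" for x
      using f_eq that by simp
  qed (use that in auto)
  have f'_deriv: "(f' has_real_derivative q\<^sup>2 / c * \<Psi>xx (q * \<eta>) t) (at \<eta>)" if "0 < \<eta>" "\<eta> < L" for \<eta>
  proof -
    have "((\<lambda>\<eta>. \<Psi>x (q * \<eta>) t) has_real_derivative \<Psi>xx (q * \<eta>) t * q) (at \<eta>)"
      using that q t \<Psi>xx by (intro DERIV_chain2[where f = "\<lambda>y. \<Psi>x y t"] DERIV_cmult_Id) (simp_all add: st)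
    from DERIV_cmult[OF this, of "q / c"] show ?thesis
      unfolding f'_def by (simp add: power2_eq_square mult_ac)
  qed
  have heat_profile: "q\<^sup>2 / c * \<Psi>xx (q * \<eta>) t = 2 * \<alpha> * f \<eta> - 2 * \<eta> * f' \<eta>" if \<eta>: "0 < \<eta>" "\<eta> < L" for \<eta>
  proof -
    let ?x = "q * \<eta>"
    have x: "0 < ?x" "?x < s t" using \<eta> q by (simp_all add: st)
    have "isCont s t" using ds t DERIV_isCont by blast
    then have "\<forall>\<^sub>F \<tau> in nhds t. ?x < s \<tau>"
      using x(2) by (auto simp: isCont_def tendsto_at_iff_tendsto_nhds dest: order_tendstoD(1))
    moreover have "\<forall>\<^sub>F \<tau> in nhds t. 0 < \<tau>"
      using eventually_nhds_in_open[of "{0<..}" t] t by simp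
    ultimately have ev: "\<forall>\<^sub>F \<tau> in nhds t. \<Psi> ?x \<tau> = \<tau> powr (\<alpha>/2) * f (?x / (2 * sqrt (d * \<tau>)))"
      by eventually_elim (use sim x(1) in auto)
    have \<eta>t: "?x / (2 * sqrt (d * t)) = \<eta>" using q by (simp add: q_def[symmetric])
    have "((\<lambda>\<tau>. ?x / (2 * sqrt (d * \<tau>))) has_real_derivative - (\<eta> / (2 * t))) (at t)"
      using similarity_variable_deriv[OF d t, of ?x] \<eta>t by simp
    moreover have "(f has_real_derivative f' \<eta>) (at (?x / (2 * sqrt (d * t))))"
      unfolding \<eta>t by (rule f_deriv[OF \<eta>])
    ultimately have "((\<lambda>\<tau>. f (?x / (2 * sqrt (d * \<tau>)))) has_real_derivative f' \<eta> * - (\<eta> / (2 * t))) (at t)"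
      by (rule DERIV_chain2[rotated])
    from DERIV_mult[OF has_real_derivative_powr[OF t, of "\<alpha>/2"] this]
    have "((\<lambda>\<tau>. \<Psi> ?x \<tau>) has_real_derivative
        \<alpha>/2 * t powr (\<alpha>/2 - 1) * f \<eta> + f' \<eta> * - (\<eta> / (2 * t)) * c) (at t)"
      unfolding DERIV_cong_ev[OF refl ev refl] \<eta>t c_def .
    then have "d * \<Psi>xx ?x t = \<alpha>/2 * t powr (\<alpha>/2 - 1) * f \<eta> + f' \<eta> * - (\<eta> / (2 * t)) * c"
      using DERIV_unique \<Psi>t heat t x by (metis greaterThanLessThan_iff)
    also have "t powr (\<alpha>/2 - 1) = c / t"
      using t by (simp add: powr_diff c_def)
    finally have *: "d * \<Psi>xx ?x t = \<alpha>/2 * (c / t) * f \<eta> + f' \<eta> * - (\<eta> / (2 * t)) * c" .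
    have "q\<^sup>2 / c * \<Psi>xx ?x t = 4 * t / c * (d * \<Psi>xx ?x t)"
      using q2 by (simp add: power2_eq_square)
    also have "\<dots> = 2 * \<alpha> * f \<eta> - 2 * \<eta> * f' \<eta>"
      unfolding * using t c by (simp add: field_simps)
    finally show ?thesis .
  qed
  have "continuous_on {0..L} f"
  proof -
    have "continuous_on {0..s t} (\<lambda>y. \<Psi> y t)"
      using \<Psi>x t by (intro DERIV_continuous_on[where D = "\<lambda>x. \<Psi>x x t"]) auto
    then have "continuous_on {0..L} (\<lambda>\<eta>. \<Psi> (q * \<eta>) t)"
      by (rule continuous_on_compose2[where f = "(*) q"]) (use in_dom in \<open>auto intro!: continuous_intros\<close>)
    then have "continuous_on {0..L} (\<lambda>\<eta>. \<Psi> (q * \<eta>) t / c)"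
      using c by (intro continuous_on_divide continuous_on_const) auto
    then show ?thesis by (rule continuous_on_eq) (simp add: f_eq)
  qed
  moreover have "continuous_on {0..L} f'"
  proof -
    have "continuous_on {0..L} (\<lambda>\<eta>. (\<lambda>(x, t). \<Psi>x x t) (q * \<eta>, t))"
      using in_dom t by (intro continuous_on_compose2[OF cont] continuous_intros) (auto simp: closed_domain_def)
    then show ?thesis unfolding f'_def by (intro continuous_intros) simp
  qed
  ultimately have ode: "profile_ode \<alpha> L f f'"
    unfolding profile_ode_def using f_deriv f'_deriv heat_profile by auto
  have "f L = 0"
    using f_eq[of L] L mp[OF spec[OF zero] t] by (simp add: st)
  moreover have "k * f' 0 = 2 * sqrt d * h\<^sub>0 * (f 0 - Tinf)"
  proof -
    have "\<Psi> 0 t = c * f 0" using f_eq[of 0] L c by simp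
    then have "k * \<Psi>x 0 t = h\<^sub>0 * t powr (-1/2) * c * (f 0 - Tinf)"
      using robin t by (simp add: c_def algebra_simps)
    moreover have "k * f' 0 = q / c * (k * \<Psi>x 0 t)"
      by (simp add: f'_def)
    ultimately have "k * f' 0 = q * t powr (-1/2) * h\<^sub>0 * (f 0 - Tinf)"
      using c by simp
    moreover have "q * t powr (-1/2) = 2 * sqrt d"
      using d t by (simp add: q_def real_sqrt_mult powr_minus_divide powr_half_sqrt flip: minus_divide_left)
    ultimately show ?thesis by simp
  qed
  moreover have "t powr (\<alpha>/2) * (k * f' L) / (2 * sqrt (d * t)) = - \<gamma> * s t powr \<alpha> * ds t"
  proof -
    have "t powr (\<alpha>/2) * (k * f' L) / (2 * sqrt (d * t)) = k * \<Psi>x (s t) t"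
      using q c by (simp add: f'_def st c_def[symmetric] q_def[symmetric])
    then show ?thesis using flux t by simp
  qed
  ultimately show ?thesis using that ode ds t by blast
qed

text \<open>The pair (f 0, f' 0) does not depend on the time at which the profile is read off, so the zeros
L t of the profile all satisfy one equation for the quotient of the odd by the even profile. That
equation has at most one positive root.\<close>
lemma similarity_solution_unique:
  fixes \<alpha> d k \<gamma> h\<^sub>0 Tinf :: real
  assumes "\<alpha> \<ge> 0" "d > 0" "k > 0" "\<gamma> > 0" "h\<^sub>0 > 0" "Tinf > 0"
    and sol: "stefan_solution \<alpha> d k \<gamma> h\<^sub>0 Tinf \<Psi> s"
    and sim: "similarity_type \<alpha> d \<Psi> s"
  obtains \<nu> where "\<nu> > 0" "front_equation \<alpha> d k \<gamma> h\<^sub>0 Tinf \<nu>"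
    "\<And>t. t \<ge> 0 \<Longrightarrow> s t = front d \<nu> t"
    "\<And>t x. t > 0 \<Longrightarrow> x \<in> {0..s t} \<Longrightarrow> \<Psi> x t = temperature \<alpha> d k h\<^sub>0 Tinf \<nu> x t"
proof -
  obtain f where f: "\<And>t x. t > 0 \<Longrightarrow> x \<in> {0..s t} \<Longrightarrow>
      \<Psi> x t = t powr (\<alpha>/2) * f (x / (2 * sqrt (d * t)))"
    using sim unfolding similarity_type_def by blast
  define L where "L = (\<lambda>t. s t / (2 * sqrt (d * t)))"
  define a where "a = f 0"
  define b where "b = 2 * sqrt d * h\<^sub>0 * (a - Tinf) / k"
  have s: "s t > 0" if "t > 0" for t
    using sol that by (simp add: stefan_solution_def)
  have L: "L t > 0" if "t > 0" for t
    using s[OF that] that assms by (simp add: L_def)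
  have red: "\<exists>f' ds. profile_ode \<alpha> (L t) f f' \<and> f (L t) = 0 \<and> f' 0 = b \<and>
      (s has_real_derivative ds) (at t) \<and>
      t powr (\<alpha>/2) * (k * f' (L t)) / (2 * sqrt (d * t)) = - \<gamma> * s t powr \<alpha> * ds"
    if t: "t > 0" for t
  proof -
    obtain f' ds where *: "profile_ode \<alpha> (L t) f f'" "f (L t) = 0"
      "k * f' 0 = 2 * sqrt d * h\<^sub>0 * (f 0 - Tinf)"
      "(s has_real_derivative ds) (at t)"
      "t powr (\<alpha>/2) * (k * f' (L t)) / (2 * sqrt (d * t)) = - \<gamma> * s t powr \<alpha> * ds"
      using similarity_solution_reduces[OF \<open>d > 0\<close> sol f t] unfolding L_def by blast
    from *(3) have "f' 0 = b"
      using \<open>k > 0\<close> by (simp add: a_def b_def field_simps)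
    with * show ?thesis by blast
  qed
  have f_rep: "f \<eta> = a * even_profile \<alpha> \<eta> + b * odd_profile \<alpha> \<eta>" if "t > 0" "\<eta> \<in> {0..L t}" for t \<eta>
    using red[OF that(1)] profile_representation[OF _ that(2)] unfolding a_def by metis
  have front_zero: "a * even_profile \<alpha> (L t) + b * odd_profile \<alpha> (L t) = 0" if "t > 0" for t
    using red[OF that] f_rep[OF that, of "L t"] L[OF that] by auto
  have e: "even_profile \<alpha> \<eta> > 0" for \<eta>
    using assms by (intro even_profile_pos) auto
  \<comment> \<open>Otherwise f would be 0 throughout, which the condition at x = 0 excludes because of Tinf > 0.\<close>
  have "b \<noteq> 0"
  proof
    assume "b = 0"
    then have "a = 0" using front_zero[of 1] e[of "L 1"] by simp
    with \<open>b = 0\<close> assms show False by (simp add: b_def)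
  qed
  then have ratio: "odd_profile \<alpha> (L t) / even_profile \<alpha> (L t) = - a / b" if "t > 0" for t
    using front_zero[OF that] e[of "L t"] by (simp add: field_simps)
  define \<nu> where "\<nu> = L 1"
  have \<nu>: "\<nu> > 0" using L by (simp add: \<nu>_def)
  have L_const: "L t = \<nu>" if "t > 0" for t
  proof (rule ccontr)
    assume "L t \<noteq> \<nu>"
    then consider "L t < \<nu>" | "\<nu> < L t" by linarith
    then show False
      using odd_even_ratio_strict_mono[of \<alpha> "L t" \<nu>] odd_even_ratio_strict_mono[of \<alpha> \<nu> "L t"]
        ratio[OF that] ratio[of 1] L[OF that] \<nu> assms(1) by cases (auto simp: \<nu>_def)
  qed
  have s_pos: "s t = front d \<nu> t" if "t > 0" for t
    using L_const[OF that] that assms by (simp add: L_def front_def field_simps)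
  have s_eq: "s t = front d \<nu> t" if "t \<ge> 0" for t
    using s_pos[of t] sol that by (cases "t = 0") (auto simp: front_def stefan_solution_def)
  have ab: "a = c\<^sub>1\<^sub>1 \<alpha> d k h\<^sub>0 Tinf \<nu>" "b = c\<^sub>2\<^sub>1 \<alpha> d k h\<^sub>0 Tinf \<nu>"
    using coefficients_unique[of \<alpha> d k h\<^sub>0 \<nu> a b Tinf] assms \<nu> front_zero[of 1]
    by (auto simp: b_def \<nu>_def)
  \<comment> \<open>The front is known now, so the Stefan condition at the single time 1 determines \<nu>.\<close>
  obtain f' ds where f': "profile_ode \<alpha> \<nu> f f'" "f \<nu> = 0" "f' 0 = b"
    and ds: "(s has_real_derivative ds) (at 1)"
    and flux: "k * f' \<nu> / (2 * sqrt d) = - \<gamma> * s 1 powr \<alpha> * ds"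
    using red[of 1] by (auto simp: \<nu>_def)
  have "ds = \<nu> * sqrt d"
  proof (rule DERIV_unique[OF ds])
    have "(front d \<nu> has_real_derivative \<nu> * sqrt d) (at 1)"
      using DERIV_cmult[OF sqrt_deriv[of d 1], of "2 * \<nu>"] \<open>d > 0\<close> by (simp add: front_def[abs_def])
    then show "(s has_real_derivative \<nu> * sqrt d) (at 1)"
      by (rule has_field_derivative_transform_within_open[where S = "{0<..}"]) (auto simp: s_pos)
  qed
  moreover have "s 1 = 2 * \<nu> * sqrt d" using s_pos[of 1] by (simp add: front_def)
  ultimately have "k * f' \<nu> = - \<gamma> * (2 * \<nu> * sqrt d) powr \<alpha> * (2 * \<nu> * (sqrt d * sqrt d))"
    using flux \<open>d > 0\<close> by (simp add: field_simps)
  moreover have "f' \<nu> = b * exp (- \<nu>\<^sup>2) / even_profile \<alpha> \<nu>"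
    using profile_slope_at_zero[OF f'(1) _ f'(2)] \<nu> e[of \<nu>] f'(3) by (simp add: field_simps)
  ultimately have "front_equation \<alpha> d k \<gamma> h\<^sub>0 Tinf \<nu>"
    using front_equation_iff_flux[of \<alpha> d k \<gamma> h\<^sub>0 \<nu> Tinf] assms \<nu> by (simp add: ab(2)[symmetric])
  moreover have "\<Psi> x t = temperature \<alpha> d k h\<^sub>0 Tinf \<nu> x t" if "t > 0" "x \<in> {0..s t}" for t x
  proof -
    have "x / (2 * sqrt (d * t)) \<in> {0..L t}"
      using that assms by (simp add: L_def divide_right_mono)
    then show ?thesis
      using f[OF that] f_rep[OF that(1)]
      by (simp add: temperature_def Let_def ab even_profile_def odd_profile_def mult.assoc)
  qed
  ultimately show ?thesis using that \<nu> s_eq by blast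
qed

section \<open>Existence and uniqueness of the similarity solution\<close>

lemma temperature_is_solution:
  assumes "\<alpha> \<ge> 0" "d > 0" "k > 0" "\<gamma> > 0" "h\<^sub>0 > 0" "\<nu> > 0"
    and front: "front_equation \<alpha> d k \<gamma> h\<^sub>0 Tinf \<nu>"
  shows "stefan_solution \<alpha> d k \<gamma> h\<^sub>0 Tinf (temperature \<alpha> d k h\<^sub>0 Tinf \<nu>) (front d \<nu>)"
proof -
  obtain e' where e: "\<And>\<eta>. (even_profile \<alpha> has_real_derivative e' \<eta>) (at \<eta>)"
    "\<And>\<eta>. (e' has_real_derivative 2 * \<alpha> * even_profile \<alpha> \<eta> - 2 * \<eta> * e' \<eta>) (at \<eta>)"
    "e' 0 = 0" using even_profile_solves by blast
  obtain o' where o: "\<And>\<eta>. (odd_profile \<alpha> has_real_derivative o' \<eta>) (at \<eta>)"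
    "\<And>\<eta>. (o' has_real_derivative 2 * \<alpha> * odd_profile \<alpha> \<eta> - 2 * \<eta> * o' \<eta>) (at \<eta>)"
    "o' 0 = 1" using odd_profile_solves by blast
  let ?a = "c\<^sub>1\<^sub>1 \<alpha> d k h\<^sub>0 Tinf \<nu>" and ?b = "c\<^sub>2\<^sub>1 \<alpha> d k h\<^sub>0 Tinf \<nu>"
  define F where "F = (\<lambda>\<eta>. ?a * even_profile \<alpha> \<eta> + ?b * odd_profile \<alpha> \<eta>)"
  define F' where "F' = (\<lambda>\<eta>. ?a * e' \<eta> + ?b * o' \<eta>)"
  have F: "(F has_real_derivative F' \<eta>) (at \<eta>)" for \<eta>
    unfolding F_def F'_def by (intro DERIV_add DERIV_cmult e o)
  have "(F' has_real_derivative ?a * (2 * \<alpha> * even_profile \<alpha> \<eta> - 2 * \<eta> * e' \<eta>)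
      + ?b * (2 * \<alpha> * odd_profile \<alpha> \<eta> - 2 * \<eta> * o' \<eta>)) (at \<eta>)" for \<eta>
    unfolding F'_def by (intro DERIV_add DERIV_cmult e o)
  moreover have "?a * (2 * \<alpha> * even_profile \<alpha> \<eta> - 2 * \<eta> * e' \<eta>)
      + ?b * (2 * \<alpha> * odd_profile \<alpha> \<eta> - 2 * \<eta> * o' \<eta>) = 2 * \<alpha> * F \<eta> - 2 * \<eta> * F' \<eta>" for \<eta>
    unfolding F_def F'_def by (simp add: algebra_simps)
  ultimately have F': "(F' has_real_derivative 2 * \<alpha> * F \<eta> - 2 * \<eta> * F' \<eta>) (at \<eta>)" for \<eta>
    by metis
  have zero: "F \<nu> = 0"
    unfolding F_def by (rule coefficients_boundary) (use assms in auto)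
  have b: "F' 0 = ?b" and a: "F 0 = ?a"
    by (simp_all add: F_def F'_def e(3) o(3))
  have robin: "k * F' 0 = 2 * sqrt d * h\<^sub>0 * (F 0 - Tinf)"
    unfolding a b by (rule coefficients_boundary) (use assms in auto)
  have "even_profile \<alpha> \<nu> * F' \<nu> = F' 0 * exp (- \<nu>\<^sup>2)"
    using profile_slope_at_zero[OF profile_odeI[OF F F'], of \<nu>] zero \<open>\<nu> > 0\<close> by simp
  moreover have "even_profile \<alpha> \<nu> > 0"
    using assms by (intro even_profile_pos) auto
  ultimately have "F' \<nu> = ?b * exp (- \<nu>\<^sup>2) / even_profile \<alpha> \<nu>"
    by (simp add: b field_simps)
  then have flux: "k * F' \<nu> = - \<gamma> * (2 * \<nu> * sqrt d) powr \<alpha> * (2 * \<nu> * d)"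
    using front_equation_iff_flux[of \<alpha> d k \<gamma> h\<^sub>0 \<nu> Tinf] assms front by simp
  have "temperature \<alpha> d k h\<^sub>0 Tinf \<nu> = (\<lambda>x t. t powr (\<alpha>/2) * F (x / (2 * sqrt (d * t))))"
    by (simp add: fun_eq_iff temperature_def Let_def F_def even_profile_def odd_profile_def mult.assoc)
  then show ?thesis
    using similarity_solution_stefan[OF \<open>d > 0\<close> \<open>\<nu> > 0\<close> F F' zero robin flux] by simp
qed

lemma temperature_similarity: "similarity_type \<alpha> d (temperature \<alpha> d k h\<^sub>0 Tinf \<nu>) s"
  unfolding similarity_type_def temperature_def Let_def
  by (rule exI[of _ "\<lambda>\<eta>. c\<^sub>1\<^sub>1 \<alpha> d k h\<^sub>0 Tinf \<nu> * kummer_M (-\<alpha>/2) (1/2) (-(\<eta>\<^sup>2))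
      + c\<^sub>2\<^sub>1 \<alpha> d k h\<^sub>0 Tinf \<nu> * \<eta> * kummer_M (-\<alpha>/2 + 1/2) (3/2) (-(\<eta>\<^sup>2))"]) simp

theorem theorem2p1:
  fixes \<alpha> d k \<gamma> h\<^sub>0 Tinf :: real
  assumes "\<alpha> \<ge> 0" and "d > 0" and "k > 0" and "\<gamma> > 0" and "h\<^sub>0 > 0" and "Tinf > 0"
  shows "\<exists>\<nu>>0.
    front_equation \<alpha> d k \<gamma> h\<^sub>0 Tinf \<nu> \<and>
    (\<forall>x>0. front_equation \<alpha> d k \<gamma> h\<^sub>0 Tinf x \<longrightarrow> x = \<nu>) \<and>
    stefan_solution \<alpha> d k \<gamma> h\<^sub>0 Tinf (temperature \<alpha> d k h\<^sub>0 Tinf \<nu>) (front d \<nu>) \<and>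
    similarity_type \<alpha> d (temperature \<alpha> d k h\<^sub>0 Tinf \<nu>) (front d \<nu>) \<and>
    (\<forall>\<Psi> s. stefan_solution \<alpha> d k \<gamma> h\<^sub>0 Tinf \<Psi> s \<and> similarity_type \<alpha> d \<Psi> s \<longrightarrow>
       (\<forall>t\<ge>0. s t = front d \<nu> t) \<and>
       (\<forall>t>0. \<forall>x\<in>{0..s t}. \<Psi> x t = temperature \<alpha> d k h\<^sub>0 Tinf \<nu> x t))"
proof -
  obtain \<nu> where \<nu>: "\<nu> > 0" "front_equation \<alpha> d k \<gamma> h\<^sub>0 Tinf \<nu>"
    and unique: "\<forall>x>0. front_equation \<alpha> d k \<gamma> h\<^sub>0 Tinf x \<longrightarrow> x = \<nu>"
    using front_equation_ex1[OF assms] by blast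
  have "(\<forall>t\<ge>0. s t = front d \<nu> t) \<and>
      (\<forall>t>0. \<forall>x\<in>{0..s t}. \<Psi> x t = temperature \<alpha> d k h\<^sub>0 Tinf \<nu> x t)"
    if sol: "stefan_solution \<alpha> d k \<gamma> h\<^sub>0 Tinf \<Psi> s" and sim: "similarity_type \<alpha> d \<Psi> s" for \<Psi> s
  proof -
    obtain \<mu> where "\<mu> > 0" "front_equation \<alpha> d k \<gamma> h\<^sub>0 Tinf \<mu>"
      "\<And>t. t \<ge> 0 \<Longrightarrow> s t = front d \<mu> t"
      "\<And>t x. t > 0 \<Longrightarrow> x \<in> {0..s t} \<Longrightarrow> \<Psi> x t = temperature \<alpha> d k h\<^sub>0 Tinf \<mu> x t"
      using similarity_solution_unique[OF assms sol sim] by blast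
    with unique show ?thesis by blast
  qed
  with \<nu> unique temperature_is_solution[OF assms(1-5) \<nu>] temperature_similarity show ?thesis
    by blast
qed

end
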